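(* Let $M$ be a $\Theta$-CR submanifold of a $\Theta$-statistical manifold $(\widetilde M,\widetilde g,\widetilde\nabla,\widetilde\nabla^{*},\Theta)$, with orthogonal decomposition $TM=D_{\Theta}\oplus D_{\Theta}^{\perp}$ into its invariant and anti-invariant distributions. (1) For $X,Y\in\Gamma(D_{\Theta})$, \[ F_{\Theta}([X,Y])=h(X,\Theta Y)-h(Y,\Theta X). \] (2) For $U,V\in\Gamma(D_{\Theta}^{\perp})$, \[ P_{\Theta}([U,V])=A_{\Theta U}V-A_{\Theta V}U. \] Consequently: (a) if $\ker(F_{\Theta}|_{TM})=D_{\Theta}$, then $D_{\Theta}$ is integrable if and only if \[ h(X,\Theta Y)=h(Y,\Theta X)\qquad\text{for all }X,Y\in\Gamma(D_{\Theta}); \] (b) if $\ker(P_{\Theta}|_{TM})=D_{\Theta}^{\perp}$, then $D_{\Theta}^{\perp}$ is integrable if and only if \[ A_{\Theta U}V=A_{\Theta V}U\qquad\text{for all }U,V\in\Gamma(D_{\Theta}^{\perp}). \]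
   Context: A statistical manifold $(\widetilde M,\widetilde g,\widetilde\nabla,\widetilde\nabla^{*})$ is a Riemannian manifold $(\widetilde M,\widetilde g)$ with two torsion-free affine connections dual with respect to $\widetilde g$: $X\widetilde g(Y,Z)=\widetilde g(\widetilde\nabla_XY,Z)+\widetilde g(Y,\widetilde\nabla_X^{*}Z)$. It is a $\Theta$-statistical manifold if it is endowed with a nonzero $(1,1)$-tensor field $\Theta$ satisfying the gauge equation $\widetilde\nabla_X(\Theta Y)=\Theta(\widetilde\nabla_X^{*}Y)$ for all vector fields $X,Y$. Let $M\hookrightarrow\widetilde M$ be an isometrically immersed submanifold with induced metric $g$. For $X,Y\in\Gamma(TM)$ and $\nu\in\Gamma(T^{\perp}M)$, the statistical Gauss--Weingarten formulas (splitting into tangential and normal parts) are \[ \widetilde\nabla_XY=\nabla_XY+h(X,Y),\quad \widetilde\nabla^{*}_XY=\nabla^{*}_XY+h^{*}(X,Y),\quad \widetilde\nabla_X\nu=-A_{\nu}X+\nabla^{\perp}_X\nu, \] which define the induced connections $\nabla,\nabla^{*}$ on $M$, the second fundamental forms $h,h^{*}$, the shape operator $A_\nu$ and the normal connection $\nabla^{\perp}$. Along $M$, write $\Theta Y=P_{\Theta}Y+F_{\Theta}Y$ for $Y\in\Gamma(TM)$, with $P_{\Theta}Y\in\Gamma(TM)$ and $F_{\Theta}Y\in\Gamma(T^{\perp}M)$. $M$ is a $\Theta$-CR submanifold if $TM$ admits an orthogonal decomposition $TM=D_{\Theta}\oplus D_{\Theta}^{\perp}$ into distributions such that $\Theta(D_{\Theta})\subset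 D_{\Theta}$ and $\Theta(D_{\Theta}^{\perp})\subset T^{\perp}M$; $D_\Theta$ and $D_\Theta^\perp$ are called the invariant and anti-invariant distributions. A distribution is integrable if the bracket of any two of its sections is again a section of it. *)

theory Defs
  imports "HOL-Analysis.Analysis"
begin

section \<open>Smooth maps between Euclidean spaces\<close>

text \<open>Only used for open \<open>S\<close>, where the full derivative \<open>at x\<close> is the right one.\<close>

primrec Ck_on :: "nat \<Rightarrow> 'e::euclidean_space set \<Rightarrow> ('e \<Rightarrow> 'f::real_normed_vector) \<Rightarrow> bool" where
  "Ck_on 0 S f \<longleftrightarrow> continuous_on S f"
| "Ck_on (Suc k) S f \<longleftrightarrow>
     (\<forall>x\<in>S. f differentiable (at x)) \<and> (\<forall>v. Ck_on k S (\<lambda>x. frechet_derivative f (at x) v))"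

definition smooth_on :: "'e::euclidean_space set \<Rightarrow> ('e \<Rightarrow> 'f::real_normed_vector) \<Rightarrow> bool" where
  "smooth_on S f \<longleftrightarrow> (\<forall>k. Ck_on k S f)"


section \<open>Smooth manifolds\<close>

text \<open>A manifold is a whole type \<open>'a\<close> of class \<open>t2_space\<close> and \<open>second_countable_topology\<close>,
  with a smooth atlas (not required to be maximal) modelled on a Euclidean space \<open>'e\<close>.  A chart is
  its domain together with its coordinate map; the map is only meaningful on the domain.\<close>

type_synonym ('a, 'e) chart = "'a set \<times> ('a \<Rightarrow> 'e)"

definition chart_inv :: "('a, 'e) chart \<Rightarrow> 'e \<Rightarrow> 'a" where
  "chart_inv c = inv_into (fst c) (snd c)"

definition is_chart :: "('a::topological_space, 'e::euclidean_space) chart \<Rightarrow> bool" where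
  "is_chart c \<longleftrightarrow> open (fst c) \<and> open (snd c ` fst c) \<and>
     homeomorphism (fst c) (snd c ` fst c) (snd c) (chart_inv c)"

definition smooth_atlas :: "('a::topological_space, 'e::euclidean_space) chart set \<Rightarrow> bool" where
  "smooth_atlas A \<longleftrightarrow> (\<forall>c\<in>A. is_chart c) \<and> (\<Union>c\<in>A. fst c) = UNIV \<and>
     (\<forall>c\<in>A. \<forall>d\<in>A. smooth_on (snd c ` (fst c \<inter> fst d)) (snd d \<circ> chart_inv c))"

definition smooth_fun ::
  "('a::topological_space, 'e::euclidean_space) chart set \<Rightarrow> ('a \<Rightarrow> real) \<Rightarrow> bool" where
  "smooth_fun A a \<longleftrightarrow> (\<forall>c\<in>A. smooth_on (snd c ` fst c) (a \<circ> chart_inv c))"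

definition smooth_map ::
  "('a::topological_space, 'e::euclidean_space) chart set \<Rightarrow>
   ('b::topological_space, 'f::euclidean_space) chart set \<Rightarrow> ('a \<Rightarrow> 'b) \<Rightarrow> bool" where
  "smooth_map A B F \<longleftrightarrow> continuous_on UNIV F \<and>
     (\<forall>c\<in>A. \<forall>d\<in>B. smooth_on (snd c ` (fst c \<inter> F -` fst d)) (snd d \<circ> F \<circ> chart_inv c))"


section \<open>Tangent vectors\<close>

text \<open>Each point \<open>p\<close> gets a preferred chart \<open>chart_at A p\<close> from the atlas.  The tangent space at
  \<open>p\<close> is the model space \<open>'e\<close>: the element \<open>v\<close> stands for the class of the pair
  \<open>(chart_at A p, v)\<close> in the usual description of tangent vectors as classes of pairs
  (chart, coordinate vector).  A vector field is therefore a function \<open>'a \<Rightarrow> 'e\<close>; as the preferred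
  chart jumps, its smoothness has to be read off from its components in a fixed chart.\<close>

definition chart_at :: "('a, 'e) chart set \<Rightarrow> 'a \<Rightarrow> ('a, 'e) chart" where
  "chart_at A p = (SOME c. c \<in> A \<and> p \<in> fst c)"

text \<open>Components in the chart \<open>c\<close> of the tangent vector \<open>v\<close> at \<open>p\<close>.\<close>

definition components ::
  "('a, 'e::euclidean_space) chart set \<Rightarrow> ('a, 'e) chart \<Rightarrow> 'a \<Rightarrow> 'e \<Rightarrow> 'e" where
  "components A c p v =
     frechet_derivative (snd c \<circ> chart_inv (chart_at A p)) (at (snd (chart_at A p) p)) v"

text \<open>Derivative of a function at \<open>p\<close> in the direction of the tangent vector \<open>v\<close> at \<open>p\<close>.\<close>

definition dir_deriv ::
  "('a, 'e::euclidean_space) chart set \<Rightarrow> ('a \<Rightarrow> 'f::real_normed_vector) \<Rightarrow> 'a \<Rightarrow> 'e \<Rightarrow> 'f" where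
  "dir_deriv A a p v =
     frechet_derivative (a \<circ> chart_inv (chart_at A p)) (at (snd (chart_at A p) p)) v"

definition differential ::
  "('a, 'e::euclidean_space) chart set \<Rightarrow> ('b, 'f::euclidean_space) chart set \<Rightarrow>
   ('a \<Rightarrow> 'b) \<Rightarrow> 'a \<Rightarrow> 'e \<Rightarrow> 'f" where
  "differential A B F p v = dir_deriv A (snd (chart_at B (F p)) \<circ> F) p v"

definition smooth_field_on ::
  "('a, 'e::euclidean_space) chart set \<Rightarrow> 'a set \<Rightarrow> ('a \<Rightarrow> 'e) \<Rightarrow> bool" where
  "smooth_field_on A U X \<longleftrightarrow>
     (\<forall>c\<in>A. smooth_on (snd c ` (fst c \<inter> U)) ((\<lambda>p. components A c p (X p)) \<circ> chart_inv c))"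

abbreviation smooth_field :: "('a, 'e::euclidean_space) chart set \<Rightarrow> ('a \<Rightarrow> 'e) \<Rightarrow> bool" where
  "smooth_field A X \<equiv> smooth_field_on A UNIV X"

text \<open>In coordinates \<open>[X, Y] = DY(X) - DX(Y)\<close>, evaluated at \<open>p\<close> in the preferred chart at \<open>p\<close>.\<close>

definition lie_bracket ::
  "('a, 'e::euclidean_space) chart set \<Rightarrow> ('a \<Rightarrow> 'e) \<Rightarrow> ('a \<Rightarrow> 'e) \<Rightarrow> 'a \<Rightarrow> 'e" where
  "lie_bracket A X Y p =
     dir_deriv A (\<lambda>q. components A (chart_at A p) q (Y q)) p (X p)
   - dir_deriv A (\<lambda>q. components A (chart_at A p) q (X q)) p (Y p)"


section \<open>Statistical manifolds\<close>

definition riemannian_metric ::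
  "('a::topological_space, 'e::euclidean_space) chart set \<Rightarrow> ('a \<Rightarrow> 'e \<Rightarrow> 'e \<Rightarrow> real) \<Rightarrow> bool" where
  "riemannian_metric A g \<longleftrightarrow>
     (\<forall>p. bilinear (g p) \<and> (\<forall>u v. g p u v = g p v u) \<and> (\<forall>v. v \<noteq> 0 \<longrightarrow> g p v v > 0)) \<and>
     (\<forall>X Y. smooth_field A X \<longrightarrow> smooth_field A Y \<longrightarrow> smooth_fun A (\<lambda>p. g p (X p) (Y p)))"

text \<open>An affine connection is only constrained on smooth vector fields.\<close>

definition affine_connection ::
  "('a::topological_space, 'e::euclidean_space) chart set \<Rightarrow>
   (('a \<Rightarrow> 'e) \<Rightarrow> ('a \<Rightarrow> 'e) \<Rightarrow> 'a \<Rightarrow> 'e) \<Rightarrow> bool" where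
  "affine_connection A nabla \<longleftrightarrow>
     (\<forall>X Y. smooth_field A X \<longrightarrow> smooth_field A Y \<longrightarrow> smooth_field A (nabla X Y)) \<and>
     (\<forall>X X' Y. smooth_field A X \<longrightarrow> smooth_field A X' \<longrightarrow> smooth_field A Y \<longrightarrow>
        nabla (\<lambda>p. X p + X' p) Y = (\<lambda>p. nabla X Y p + nabla X' Y p)) \<and>
     (\<forall>a X Y. smooth_fun A a \<longrightarrow> smooth_field A X \<longrightarrow> smooth_field A Y \<longrightarrow>
        nabla (\<lambda>p. a p *\<^sub>R X p) Y = (\<lambda>p. a p *\<^sub>R nabla X Y p)) \<and>
     (\<forall>X Y Y'. smooth_field A X \<longrightarrow> smooth_field A Y \<longrightarrow> smooth_field A Y' \<longrightarrow>
        nabla X (\<lambda>p. Y p + Y' p) = (\<lambda>p. nabla X Y p + nabla X Y' p)) \<and>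
     (\<forall>a X Y. smooth_fun A a \<longrightarrow> smooth_field A X \<longrightarrow> smooth_field A Y \<longrightarrow>
        nabla X (\<lambda>p. a p *\<^sub>R Y p) =
          (\<lambda>p. dir_deriv A a p (X p) *\<^sub>R Y p + a p *\<^sub>R nabla X Y p))"

definition torsion_free ::
  "('a, 'e::euclidean_space) chart set \<Rightarrow> (('a \<Rightarrow> 'e) \<Rightarrow> ('a \<Rightarrow> 'e) \<Rightarrow> 'a \<Rightarrow> 'e) \<Rightarrow> bool" where
  "torsion_free A nabla \<longleftrightarrow>
     (\<forall>X Y. smooth_field A X \<longrightarrow> smooth_field A Y \<longrightarrow>
        (\<forall>p. nabla X Y p - nabla Y X p = lie_bracket A X Y p))"

definition dual_connections ::
  "('a, 'e::euclidean_space) chart set \<Rightarrow> ('a \<Rightarrow> 'e \<Rightarrow> 'e \<Rightarrow> real) \<Rightarrow>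
   (('a \<Rightarrow> 'e) \<Rightarrow> ('a \<Rightarrow> 'e) \<Rightarrow> 'a \<Rightarrow> 'e) \<Rightarrow>
   (('a \<Rightarrow> 'e) \<Rightarrow> ('a \<Rightarrow> 'e) \<Rightarrow> 'a \<Rightarrow> 'e) \<Rightarrow> bool" where
  "dual_connections A g nabla nabla' \<longleftrightarrow>
     (\<forall>X Y Z. smooth_field A X \<longrightarrow> smooth_field A Y \<longrightarrow> smooth_field A Z \<longrightarrow>
        (\<forall>p. dir_deriv A (\<lambda>q. g q (Y q) (Z q)) p (X p) =
               g p (nabla X Y p) (Z p) + g p (Y p) (nabla' X Z p)))"

definition statistical_manifold ::
  "('a::{t2_space, second_countable_topology}, 'e::euclidean_space) chart set \<Rightarrow>
   ('a \<Rightarrow> 'e \<Rightarrow> 'e \<Rightarrow> real) \<Rightarrow>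
   (('a \<Rightarrow> 'e) \<Rightarrow> ('a \<Rightarrow> 'e) \<Rightarrow> 'a \<Rightarrow> 'e) \<Rightarrow>
   (('a \<Rightarrow> 'e) \<Rightarrow> ('a \<Rightarrow> 'e) \<Rightarrow> 'a \<Rightarrow> 'e) \<Rightarrow> bool" where
  "statistical_manifold A g nabla nabla' \<longleftrightarrow>
     smooth_atlas A \<and> riemannian_metric A g \<and>
     affine_connection A nabla \<and> affine_connection A nabla' \<and>
     torsion_free A nabla \<and> torsion_free A nabla' \<and>
     dual_connections A g nabla nabla'"

definition tensor11_field ::
  "('a, 'e::euclidean_space) chart set \<Rightarrow> ('a \<Rightarrow> 'e \<Rightarrow> 'e) \<Rightarrow> bool" where
  "tensor11_field A \<Theta> \<longleftrightarrow> (\<forall>p. linear (\<Theta> p)) \<and>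
     (\<forall>X. smooth_field A X \<longrightarrow> smooth_field A (\<lambda>p. \<Theta> p (X p)))"

definition theta_statistical_manifold ::
  "('a::{t2_space, second_countable_topology}, 'e::euclidean_space) chart set \<Rightarrow>
   ('a \<Rightarrow> 'e \<Rightarrow> 'e \<Rightarrow> real) \<Rightarrow>
   (('a \<Rightarrow> 'e) \<Rightarrow> ('a \<Rightarrow> 'e) \<Rightarrow> 'a \<Rightarrow> 'e) \<Rightarrow>
   (('a \<Rightarrow> 'e) \<Rightarrow> ('a \<Rightarrow> 'e) \<Rightarrow> 'a \<Rightarrow> 'e) \<Rightarrow>
   ('a \<Rightarrow> 'e \<Rightarrow> 'e) \<Rightarrow> bool" where
  "theta_statistical_manifold A g nabla nabla' \<Theta> \<longleftrightarrow>
     statistical_manifold A g nabla nabla' \<and> tensor11_field A \<Theta> \<and>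
     (\<exists>p v. \<Theta> p v \<noteq> 0) \<and>
     (\<forall>X Y. smooth_field A X \<longrightarrow> smooth_field A Y \<longrightarrow>
        (\<forall>p. nabla X (\<lambda>q. \<Theta> q (Y q)) p = \<Theta> p (nabla' X Y p)))"


section \<open>Immersed submanifolds\<close>

text \<open>Throughout, \<open>A\<close> is the atlas of the submanifold, \<open>B\<close> that of the ambient manifold and \<open>F\<close>
  the immersion.  Sections of the pulled-back tangent bundle (vector fields along \<open>F\<close>) are functions
  \<open>W :: 'a \<Rightarrow> 'f\<close>, with \<open>W p\<close> a tangent vector at \<open>F p\<close>.  The identification of a vector field \<open>Y\<close>
  on the submanifold with a field along \<open>F\<close> is the explicit map \<open>push_field\<close>.\<close>

definition immersion ::
  "('a::topological_space, 'e::euclidean_space) chart set \<Rightarrow>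
   ('b::topological_space, 'f::euclidean_space) chart set \<Rightarrow> ('a \<Rightarrow> 'b) \<Rightarrow> bool" where
  "immersion A B F \<longleftrightarrow> smooth_map A B F \<and> (\<forall>p. inj (differential A B F p))"

definition induced_metric ::
  "('a, 'e::euclidean_space) chart set \<Rightarrow> ('b, 'f::euclidean_space) chart set \<Rightarrow>
   ('a \<Rightarrow> 'b) \<Rightarrow> ('b \<Rightarrow> 'f \<Rightarrow> 'f \<Rightarrow> real) \<Rightarrow> 'a \<Rightarrow> 'e \<Rightarrow> 'e \<Rightarrow> real" where
  "induced_metric A B F g p u v = g (F p) (differential A B F p u) (differential A B F p v)"

definition push_field ::
  "('a, 'e::euclidean_space) chart set \<Rightarrow> ('b, 'f::euclidean_space) chart set \<Rightarrow>
   ('a \<Rightarrow> 'b) \<Rightarrow> ('a \<Rightarrow> 'e) \<Rightarrow> 'a \<Rightarrow> 'f" where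
  "push_field A B F Y p = differential A B F p (Y p)"

text \<open>A global smooth vector field which near \<open>q\<close> has the constant components \<open>w\<close> in the
  preferred chart at \<open>q\<close>.  Such fields exist by a bump function argument.\<close>

definition const_field ::
  "('b::topological_space, 'f::euclidean_space) chart set \<Rightarrow> 'b \<Rightarrow> 'f \<Rightarrow> 'b \<Rightarrow> 'f" where
  "const_field B q w = (SOME E. smooth_field B E \<and>
     (\<exists>U. open U \<and> q \<in> U \<and> (\<forall>r\<in>U. components B (chart_at B q) r (E r) = w)))"

text \<open>The covariant derivative, with respect to an ambient connection, of a field \<open>W\<close> along \<open>F\<close> in
  the direction of a vector field \<open>X\<close> on the submanifold, i.e. the pulled-back connection.  With
  \<open>(y\<^sup>k)\<close> the preferred coordinates at \<open>F p\<close> and \<open>W = W\<^sup>k (\<partial>\<^sub>k \<circ> F)\<close> near \<open>p\<close>, this is the usual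
  expression \<open>X(W\<^sup>k) \<partial>\<^sub>k + W\<^sup>k \<nabla>(F\<^sub>* X, \<partial>\<^sub>k)\<close>; the second summand is the Christoffel term
  and only depends on the values of \<open>F\<^sub>* X\<close> and \<open>W\<close> at \<open>p\<close>.\<close>

definition connection_along ::
  "('a, 'e::euclidean_space) chart set \<Rightarrow> ('b::topological_space, 'f::euclidean_space) chart set \<Rightarrow>
   ('a \<Rightarrow> 'b) \<Rightarrow> (('b \<Rightarrow> 'f) \<Rightarrow> ('b \<Rightarrow> 'f) \<Rightarrow> 'b \<Rightarrow> 'f) \<Rightarrow> ('a \<Rightarrow> 'e) \<Rightarrow> ('a \<Rightarrow> 'f) \<Rightarrow> 'a \<Rightarrow> 'f" where
  "connection_along A B F nabla X W p =
     dir_deriv A (\<lambda>r. components B (chart_at B (F p)) (F r) (W r)) p (X p)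
   + nabla (const_field B (F p) (push_field A B F X p)) (const_field B (F p) (W p)) (F p)"

definition normal_space ::
  "('a, 'e::euclidean_space) chart set \<Rightarrow> ('b, 'f::euclidean_space) chart set \<Rightarrow>
   ('a \<Rightarrow> 'b) \<Rightarrow> ('b \<Rightarrow> 'f \<Rightarrow> 'f \<Rightarrow> real) \<Rightarrow> 'a \<Rightarrow> 'f set" where
  "normal_space A B F g p = {w. \<forall>u. g (F p) w (differential A B F p u) = 0}"

text \<open>The tangential part is an element of the tangent space of the submanifold, the normal part one
  of the tangent space of the ambient manifold.\<close>

definition tangential_part ::
  "('a, 'e::euclidean_space) chart set \<Rightarrow> ('b, 'f::euclidean_space) chart set \<Rightarrow>
   ('a \<Rightarrow> 'b) \<Rightarrow> ('b \<Rightarrow> 'f \<Rightarrow> 'f \<Rightarrow> real) \<Rightarrow> 'a \<Rightarrow> 'f \<Rightarrow> 'e" where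
  "tangential_part A B F g p w =
     (THE v. w - differential A B F p v \<in> normal_space A B F g p)"

definition normal_part ::
  "('a, 'e::euclidean_space) chart set \<Rightarrow> ('b, 'f::euclidean_space) chart set \<Rightarrow>
   ('a \<Rightarrow> 'b) \<Rightarrow> ('b \<Rightarrow> 'f \<Rightarrow> 'f \<Rightarrow> real) \<Rightarrow> 'a \<Rightarrow> 'f \<Rightarrow> 'f" where
  "normal_part A B F g p w = w - differential A B F p (tangential_part A B F g p w)"

definition second_fundamental_form ::
  "('a, 'e::euclidean_space) chart set \<Rightarrow> ('b::topological_space, 'f::euclidean_space) chart set \<Rightarrow>
   ('a \<Rightarrow> 'b) \<Rightarrow> ('b \<Rightarrow> 'f \<Rightarrow> 'f \<Rightarrow> real) \<Rightarrow> (('b \<Rightarrow> 'f) \<Rightarrow> ('b \<Rightarrow> 'f) \<Rightarrow> 'b \<Rightarrow> 'f) \<Rightarrow>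
   ('a \<Rightarrow> 'e) \<Rightarrow> ('a \<Rightarrow> 'e) \<Rightarrow> 'a \<Rightarrow> 'f" where
  "second_fundamental_form A B F g nabla X Y p =
     normal_part A B F g p (connection_along A B F nabla X (push_field A B F Y) p)"

definition shape_operator ::
  "('a, 'e::euclidean_space) chart set \<Rightarrow> ('b::topological_space, 'f::euclidean_space) chart set \<Rightarrow>
   ('a \<Rightarrow> 'b) \<Rightarrow> ('b \<Rightarrow> 'f \<Rightarrow> 'f \<Rightarrow> real) \<Rightarrow> (('b \<Rightarrow> 'f) \<Rightarrow> ('b \<Rightarrow> 'f) \<Rightarrow> 'b \<Rightarrow> 'f) \<Rightarrow>
   ('a \<Rightarrow> 'f) \<Rightarrow> ('a \<Rightarrow> 'e) \<Rightarrow> 'a \<Rightarrow> 'e" where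
  "shape_operator A B F g nabla \<nu> X p =
     - tangential_part A B F g p (connection_along A B F nabla X \<nu> p)"


section \<open>Theta-CR submanifolds\<close>

text \<open>The restriction of \<open>\<Theta>\<close> to tangent vectors of the submanifold, and its tangential and normal
  parts \<open>P\<close> and \<open>F\<close>.\<close>

definition theta_along ::
  "('a, 'e::euclidean_space) chart set \<Rightarrow> ('b, 'f::euclidean_space) chart set \<Rightarrow>
   ('a \<Rightarrow> 'b) \<Rightarrow> ('b \<Rightarrow> 'f \<Rightarrow> 'f) \<Rightarrow> 'a \<Rightarrow> 'e \<Rightarrow> 'f" where
  "theta_along A B F \<Theta> p v = \<Theta> (F p) (differential A B F p v)"

definition theta_P ::
  "('a, 'e::euclidean_space) chart set \<Rightarrow> ('b, 'f::euclidean_space) chart set \<Rightarrow>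
   ('a \<Rightarrow> 'b) \<Rightarrow> ('b \<Rightarrow> 'f \<Rightarrow> 'f \<Rightarrow> real) \<Rightarrow> ('b \<Rightarrow> 'f \<Rightarrow> 'f) \<Rightarrow> 'a \<Rightarrow> 'e \<Rightarrow> 'e" where
  "theta_P A B F g \<Theta> p v = tangential_part A B F g p (theta_along A B F \<Theta> p v)"

definition theta_F ::
  "('a, 'e::euclidean_space) chart set \<Rightarrow> ('b, 'f::euclidean_space) chart set \<Rightarrow>
   ('a \<Rightarrow> 'b) \<Rightarrow> ('b \<Rightarrow> 'f \<Rightarrow> 'f \<Rightarrow> real) \<Rightarrow> ('b \<Rightarrow> 'f \<Rightarrow> 'f) \<Rightarrow> 'a \<Rightarrow> 'e \<Rightarrow> 'f" where
  "theta_F A B F g \<Theta> p v = normal_part A B F g p (theta_along A B F \<Theta> p v)"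

text \<open>\<open>\<Theta>Y\<close> as a vector field on the submanifold, meaningful where \<open>\<Theta>Y\<close> is tangent to it: the field
  pushed forward to \<open>\<Theta>Y\<close>.\<close>

definition theta_tangent_field ::
  "('a, 'e::euclidean_space) chart set \<Rightarrow> ('b, 'f::euclidean_space) chart set \<Rightarrow>
   ('a \<Rightarrow> 'b) \<Rightarrow> ('b \<Rightarrow> 'f \<Rightarrow> 'f) \<Rightarrow> ('a \<Rightarrow> 'e) \<Rightarrow> 'a \<Rightarrow> 'e" where
  "theta_tangent_field A B F \<Theta> Y p =
     (THE v. differential A B F p v = theta_along A B F \<Theta> p (Y p))"

text \<open>A distribution is a smooth subbundle of the tangent bundle: it has a smooth local frame around
  each point, of a rank which may depend on the connected component.\<close>

definition distribution ::
  "('a::topological_space, 'e::euclidean_space) chart set \<Rightarrow> ('a \<Rightarrow> 'e set) \<Rightarrow> bool" where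
  "distribution A D \<longleftrightarrow>
     (\<forall>p. \<exists>U k X. open U \<and> p \<in> U \<and> (\<forall>i<k. smooth_field_on A U (X i)) \<and>
        (\<forall>q\<in>U. inj_on (\<lambda>i. X i q) {..<k} \<and> independent ((\<lambda>i. X i q) ` {..<k::nat}) \<and>
                span ((\<lambda>i. X i q) ` {..<k}) = D q))"

definition sections ::
  "('a, 'e::euclidean_space) chart set \<Rightarrow> ('a \<Rightarrow> 'e set) \<Rightarrow> ('a \<Rightarrow> 'e) set" where
  "sections A D = {X. smooth_field A X \<and> (\<forall>p. X p \<in> D p)}"

definition integrable_distribution ::
  "('a, 'e::euclidean_space) chart set \<Rightarrow> ('a \<Rightarrow> 'e set) \<Rightarrow> bool" where
  "integrable_distribution A D \<longleftrightarrow>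
     (\<forall>X\<in>sections A D. \<forall>Y\<in>sections A D. lie_bracket A X Y \<in> sections A D)"

text \<open>That the sum is direct follows from orthogonality.\<close>

definition theta_CR_submanifold ::
  "('a::{t2_space, second_countable_topology}, 'e::euclidean_space) chart set \<Rightarrow>
   ('b::{t2_space, second_countable_topology}, 'f::euclidean_space) chart set \<Rightarrow> ('a \<Rightarrow> 'b) \<Rightarrow>
   ('b \<Rightarrow> 'f \<Rightarrow> 'f \<Rightarrow> real) \<Rightarrow> ('b \<Rightarrow> 'f \<Rightarrow> 'f) \<Rightarrow> ('a \<Rightarrow> 'e set) \<Rightarrow> ('a \<Rightarrow> 'e set) \<Rightarrow> bool" where
  "theta_CR_submanifold A B F g \<Theta> D D' \<longleftrightarrow>
     smooth_atlas A \<and> immersion A B F \<and> distribution A D \<and> distribution A D' \<and>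
     (\<forall>p. (\<forall>u\<in>D p. \<forall>w\<in>D' p. induced_metric A B F g p u w = 0) \<and>
          (\<forall>v. \<exists>u\<in>D p. \<exists>w\<in>D' p. v = u + w)) \<and>
     (\<forall>p. \<forall>v\<in>D p. theta_along A B F \<Theta> p v \<in> differential A B F p ` D p) \<and>
     (\<forall>p. \<forall>v\<in>D' p. theta_along A B F \<Theta> p v \<in> normal_space A B F g p)"

end

theory Submission
  imports Defs
begin

text \<open>Everything follows from one identity for fields \<open>X\<close>, \<open>Y\<close> on the submanifold.  The dual connection
  \<open>\<nabla>\<^sup>*\<close> is torsion-free, so \<open>[X, Y] = \<nabla>\<^sup>*\<^sub>XY - \<nabla>\<^sup>*\<^sub>YX\<close> along the immersion; applying \<open>\<Theta>\<close> and the gauge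
  equation gives \<open>\<Theta>[X, Y] = \<nabla>\<^sub>X(\<Theta>Y) - \<nabla>\<^sub>Y(\<Theta>X)\<close> (lemma \<open>theta_bracket\<close>).  For sections of the invariant
  distribution \<open>\<Theta>X\<close> and \<open>\<Theta>Y\<close> are tangent, and the normal part of the identity is the formula for \<open>F\<^sub>\<Theta>\<close>.  For
  sections of the anti-invariant distribution they are normal, and the tangential part of the identity, by the
  Weingarten formula, is the formula for \<open>P\<^sub>\<Theta>\<close>.  If the kernel of \<open>F\<^sub>\<Theta>\<close> (or \<open>P\<^sub>\<Theta>\<close>) is the distribution, then a
  bracket, which is always smooth, is a section exactly when \<open>F\<^sub>\<Theta>\<close> (or \<open>P\<^sub>\<Theta>\<close>) kills it.

  The work lies in transferring torsion-freeness and the gauge equation, which concern global fields on the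
  ambient manifold, to the pulled-back connection on fields along the immersion.  A field along an immersion
  need not extend to the ambient manifold, so both transfers are computed in the preferred chart at the image
  point, where the pulled-back connection is a derivative of components plus a Christoffel term
  (\<open>connection_along_torsion_free\<close> and \<open>connection_along_tensor\<close>).  Three ingredients support this: symmetry of
  second derivatives, which makes brackets natural (\<open>bracket_pushforward\<close>); bump functions, which provide
  global fields with prescribed components near a point and show that connections are local
  (\<open>nabla_local\<close>); and the coordinate formula for a connection (\<open>nabla_eq_const_field\<close>).\<close>

section \<open>Calculus of smooth maps\<close>

abbreviation fderiv :: "('e::real_normed_vector \<Rightarrow> 'f::real_normed_vector) \<Rightarrow> 'e \<Rightarrow> 'e \<Rightarrow> 'f" where
  "fderiv f x \<equiv> frechet_derivative f (at x)"

lemma has_derivative_fderiv: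
  "f differentiable (at x) \<Longrightarrow> (f has_derivative fderiv f x) (at x)"
  by (simp add: frechet_derivative_works)

lemma fderiv_eq: "(f has_derivative f') (at x) \<Longrightarrow> fderiv f x = f'"
  using frechet_derivative_at by metis

lemma linear_fderiv: "f differentiable (at x) \<Longrightarrow> linear (fderiv f x)"
  using has_derivative_fderiv has_derivative_linear by blast

lemma fderiv_cong:
  assumes "open S" "x \<in> S" "\<And>y. y \<in> S \<Longrightarrow> f y = g y"
  shows "fderiv f x = fderiv g x"
proof -
  have "(f has_derivative L) (at x) \<longleftrightarrow> (g has_derivative L) (at x)" for L
    using has_derivative_transform_within_open[of f L x UNIV S g]
      has_derivative_transform_within_open[of g L x UNIV S f] assms by auto
  then show ?thesis by (simp add: frechet_derivative_def)
qed

lemma differentiable_cong_open: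
  assumes "open S" "x \<in> S" "\<And>y. y \<in> S \<Longrightarrow> f y = g y" "f differentiable (at x)"
  shows "g differentiable (at x)"
  using assms has_derivative_transform_within_open unfolding differentiable_def by blast

lemma Ck_on_subset: "Ck_on k S f \<Longrightarrow> T \<subseteq> S \<Longrightarrow> Ck_on k T f"
  by (induction k arbitrary: f) (auto intro: continuous_on_subset)

lemma Ck_on_cong:
  assumes "open S" "\<And>x. x \<in> S \<Longrightarrow> f x = g x" "Ck_on k S f"
  shows "Ck_on k S g"
  using assms(2,3)
proof (induction k arbitrary: f g)
  case 0
  then show ?case by (simp cong: continuous_on_cong)
next
  case (Suc k)
  have "Ck_on k S (\<lambda>x. fderiv g x v)" for v
  proof (rule Suc.IH)
    show "Ck_on k S (\<lambda>x. fderiv f x v)" using Suc.prems by simp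
    show "fderiv f x v = fderiv g x v" if "x \<in> S" for x
      using fderiv_cong[OF assms(1) that Suc.prems(1)] by simp
  qed
  moreover have "g differentiable (at x)" if "x \<in> S" for x
    using differentiable_cong_open[OF assms(1) that Suc.prems(1)] Suc.prems(2) that by simp
  ultimately show ?case by simp
qed

lemma Ck_on_local:
  assumes "\<And>x. x \<in> S \<Longrightarrow> \<exists>U. open U \<and> x \<in> U \<and> Ck_on k U f"
  shows "Ck_on k S f"
  using assms
proof (induction k arbitrary: f)
  case 0
  then have "isCont f x" if "x \<in> S" for x
    using that by (metis Ck_on.simps(1) continuous_on_eq_continuous_at)
  then show ?case by (simp add: continuous_at_imp_continuous_on)
next
  case (Suc k)
  have "f differentiable (at x)" if "x \<in> S" for x
    using Suc.prems[OF that] by auto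
  moreover have "Ck_on k S (\<lambda>x. fderiv f x v)" for v
    by (rule Suc.IH) (use Suc.prems in fastforce)
  ultimately show ?case by simp
qed

lemma Ck_on_SucD: "Ck_on (Suc k) S f \<Longrightarrow> Ck_on k S f"
proof (induction k arbitrary: f)
  case 0
  then show ?case
    by (auto intro!: continuous_at_imp_continuous_on differentiable_imp_continuous_within)
next
  case (Suc k)
  then show ?case by (metis Ck_on.simps(2))
qed

lemma Ck_on_const: "Ck_on k S (\<lambda>x. c)"
  by (induction k arbitrary: c) auto

text \<open>The derivative of a linear map is constant in the base point, so a single differentiation step
  reduces the claim to constants.\<close>

lemma Ck_on_bounded_linear:
  assumes "bounded_linear L" shows "Ck_on k S L"
proof (cases k)
  case 0
  then show ?thesis using assms by (simp add: linear_continuous_on)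
next
  case (Suc j)
  have "fderiv L x = L" for x
    using assms by (intro fderiv_eq bounded_linear_imp_has_derivative)
  then show ?thesis using Suc assms
    by (auto intro: Ck_on_const bounded_linear_imp_differentiable)
qed

lemma Ck_on_add:
  "Ck_on k S f \<Longrightarrow> Ck_on k S g \<Longrightarrow> open S \<Longrightarrow> Ck_on k S (\<lambda>x. f x + g x)"
proof (induction k arbitrary: f g)
  case 0
  then show ?case by (simp add: continuous_on_add)
next
  case (Suc k)
  have hd: "((\<lambda>x. f x + g x) has_derivative (\<lambda>v. fderiv f x v + fderiv g x v)) (at x)"
    if "x \<in> S" for x
    using Suc.prems that by (intro has_derivative_add has_derivative_fderiv) auto
  have "Ck_on k S (\<lambda>x. fderiv f x v + fderiv g x v)" for v
    using Suc.prems by (intro Suc.IH) auto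
  then have "Ck_on k S (\<lambda>x. fderiv (\<lambda>x. f x + g x) x v)" for v
    by (rule Ck_on_cong[OF Suc.prems(3), rotated]) (simp add: fderiv_eq[OF hd])
  then show ?case using differentiableI[OF hd] by simp
qed

text \<open>The product rule expresses the derivative through products of \<open>f\<close>, \<open>g\<close> and their derivatives,
  all of class \<open>C\<^sup>k\<close>; hence the induction must run over all pairs \<open>f\<close>, \<open>g\<close> at once.\<close>

lemma Ck_on_bilinear:
  assumes B: "bounded_bilinear B" and S: "open S"
  shows "Ck_on k S f \<Longrightarrow> Ck_on k S g \<Longrightarrow> Ck_on k S (\<lambda>x. B (f x) (g x))"
proof (induction k arbitrary: f g)
  case 0
  then show ?case using bounded_bilinear.continuous_on[OF B] by simp
next
  case (Suc k)
  have hd: "((\<lambda>x. B (f x) (g x)) has_derivative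
      (\<lambda>v. B (f x) (fderiv g x v) + B (fderiv f x v) (g x))) (at x)" if "x \<in> S" for x
    using Suc.prems that by (intro bounded_bilinear.FDERIV[OF B] has_derivative_fderiv) auto
  have f: "Ck_on k S f" "Ck_on k S (\<lambda>x. fderiv f x v)"
    and g: "Ck_on k S g" "Ck_on k S (\<lambda>x. fderiv g x v)" for v
    using Suc.prems Ck_on_SucD[of k S f] Ck_on_SucD[of k S g] by simp_all
  have "Ck_on k S (\<lambda>x. B (f x) (fderiv g x v) + B (fderiv f x v) (g x))" for v
    by (intro Ck_on_add Suc.IH f g S)
  then have "Ck_on k S (\<lambda>x. fderiv (\<lambda>x. B (f x) (g x)) x v)" for v
    by (rule Ck_on_cong[OF S, rotated]) (simp add: fderiv_eq[OF hd])
  then show ?case using differentiableI[OF hd] by simp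
qed

lemma Ck_on_sum:
  assumes "finite I" "open S" "\<And>i. i \<in> I \<Longrightarrow> Ck_on k S (f i)"
  shows "Ck_on k S (\<lambda>x. \<Sum>i\<in>I. f i x)"
  using assms(1,3) by (induction I) (auto intro: Ck_on_const Ck_on_add assms(2))

text \<open>\<open>Ck_on\<close> controls derivatives only in a fixed direction.  Expanding the direction in a basis is what
  lets derivatives in a varying direction be treated as finite sums of products.\<close>

lemma linear_eq_sum_Basis:
  fixes L :: "'e::euclidean_space \<Rightarrow> 'f::real_vector"
  assumes "linear L"
  shows "L v = (\<Sum>b\<in>Basis. (v \<bullet> b) *\<^sub>R L b)"
proof -
  have "L v = L (\<Sum>b\<in>Basis. (v \<bullet> b) *\<^sub>R b)" by (simp add: euclidean_representation)
  then show ?thesis by (simp add: linear_sum[OF assms] linear_cmul[OF assms])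
qed

lemma Ck_on_inner:
  assumes "open S" "Ck_on k S f" shows "Ck_on k S (\<lambda>x. f x \<bullet> b)"
  by (rule Ck_on_bilinear[OF bounded_bilinear_inner assms Ck_on_const])

text \<open>By the chain rule the derivative is \<open>\<Sum>\<^sub>b (Df(x)v \<bullet> b) Dg(f x)b\<close>, and \<open>Dg(\<cdot>)b \<circ> f\<close> is again a composition,
  with one derivative less to control.\<close>

lemma Ck_on_comp:
  fixes f :: "'e::euclidean_space \<Rightarrow> 'f::euclidean_space" and g :: "'f \<Rightarrow> 'h::real_normed_vector"
  assumes S: "open S" and T: "f ` S \<subseteq> T" and f: "Ck_on k S f" and g: "Ck_on k T g"
  shows "Ck_on k S (\<lambda>x. g (f x))"
  using f g
proof (induction k arbitrary: g)
  case 0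
  then show ?case using continuous_on_compose2 T by auto
next
  case (Suc k)
  have fd: "f differentiable (at x)" and gd: "g differentiable (at (f x))" if "x \<in> S" for x
    using Suc.prems that T by auto
  have hd: "((\<lambda>x. g (f x)) has_derivative (\<lambda>v. fderiv g (f x) (fderiv f x v))) (at x)"
    if "x \<in> S" for x
    using has_derivative_compose[OF has_derivative_fderiv[OF fd[OF that]]
        has_derivative_fderiv[OF gd[OF that]]] .
  have "Ck_on k S (\<lambda>x. fderiv (\<lambda>x. g (f x)) x v)" for v
  proof (rule Ck_on_cong[OF S])
    show "Ck_on k S (\<lambda>x. \<Sum>b\<in>Basis. (fderiv f x v \<bullet> b) *\<^sub>R fderiv g (f x) b)"
    proof (intro Ck_on_sum S Ck_on_bilinear[OF bounded_bilinear_scaleR] Ck_on_inner)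
      show "Ck_on k S (\<lambda>x. fderiv f x v)" using Suc.prems by simp
      show "Ck_on k S (\<lambda>x. fderiv g (f x) b)" for b
        by (rule Suc.IH) (use Suc.prems Ck_on_SucD in auto)
    qed auto
    show "(\<Sum>b\<in>Basis. (fderiv f x v \<bullet> b) *\<^sub>R fderiv g (f x) b) = fderiv (\<lambda>x. g (f x)) x v"
      if "x \<in> S" for x
      unfolding fderiv_eq[OF hd[OF that]]
      by (rule linear_eq_sum_Basis[OF linear_fderiv[OF gd[OF that]], symmetric])
  qed
  then show ?case using differentiableI[OF hd] by simp
qed

lemma smooth_on_Ck: "smooth_on S f \<Longrightarrow> Ck_on k S f"
  by (simp add: smooth_on_def)

lemma smooth_on_subset: "smooth_on S f \<Longrightarrow> T \<subseteq> S \<Longrightarrow> smooth_on T f"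
  unfolding smooth_on_def using Ck_on_subset by blast

lemma smooth_on_cong:
  "open S \<Longrightarrow> (\<And>x. x \<in> S \<Longrightarrow> f x = g x) \<Longrightarrow> smooth_on S f \<Longrightarrow> smooth_on S g"
  unfolding smooth_on_def using Ck_on_cong by blast

lemma smooth_on_local:
  "(\<And>x. x \<in> S \<Longrightarrow> \<exists>U. open U \<and> x \<in> U \<and> smooth_on U f) \<Longrightarrow> smooth_on S f"
  unfolding smooth_on_def by (meson Ck_on_local)

lemma smooth_on_const: "smooth_on S (\<lambda>x. c)"
  by (simp add: smooth_on_def Ck_on_const)

lemma smooth_on_ident: "smooth_on S (\<lambda>x. x)"
  by (simp add: smooth_on_def Ck_on_bounded_linear bounded_linear_ident)

lemma smooth_on_add:
  "open S \<Longrightarrow> smooth_on S f \<Longrightarrow> smooth_on S g \<Longrightarrow> smooth_on S (\<lambda>x. f x + g x)"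
  by (simp add: smooth_on_def Ck_on_add)

lemma smooth_on_scaleR:
  "open S \<Longrightarrow> smooth_on S a \<Longrightarrow> smooth_on S f \<Longrightarrow> smooth_on S (\<lambda>x. a x *\<^sub>R f x)"
  by (simp add: smooth_on_def Ck_on_bilinear[OF bounded_bilinear_scaleR])

lemma smooth_on_inner:
  "open S \<Longrightarrow> smooth_on S f \<Longrightarrow> smooth_on S (\<lambda>x. f x \<bullet> b)"
  by (simp add: smooth_on_def Ck_on_inner)

lemma smooth_on_comp:
  fixes f :: "'e::euclidean_space \<Rightarrow> 'f::euclidean_space" and g :: "'f \<Rightarrow> 'h::real_normed_vector"
  assumes "open S" "f ` S \<subseteq> T" "smooth_on S f" "smooth_on T g"
  shows "smooth_on S (\<lambda>x. g (f x))"
  using assms by (simp add: smooth_on_def Ck_on_comp)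

lemma smooth_on_differentiable: "smooth_on S f \<Longrightarrow> x \<in> S \<Longrightarrow> f differentiable (at x)"
  using smooth_on_Ck[of S f "Suc 0"] by auto

lemma smooth_on_fderiv: "smooth_on S f \<Longrightarrow> smooth_on S (\<lambda>x. fderiv f x v)"
  unfolding smooth_on_def using Ck_on.simps(2) by blast

lemma smooth_on_fderiv_apply:
  fixes f :: "'e::euclidean_space \<Rightarrow> 'f::real_normed_vector" and w :: "'e \<Rightarrow> 'e"
  assumes S: "open S" and f: "smooth_on S f" and w: "smooth_on S w"
  shows "smooth_on S (\<lambda>x. fderiv f x (w x))"
proof (rule smooth_on_cong[OF S])
  show "smooth_on S (\<lambda>x. \<Sum>b\<in>Basis. (w x \<bullet> b) *\<^sub>R fderiv f x b)"
    using smooth_on_scaleR[OF S smooth_on_inner[OF S w] smooth_on_fderiv[OF f]]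
    unfolding smooth_on_def by (intro allI Ck_on_sum S finite_Basis) auto
  show "(\<Sum>b\<in>Basis. (w x \<bullet> b) *\<^sub>R fderiv f x b) = fderiv f x (w x)" if "x \<in> S" for x
    by (rule linear_eq_sum_Basis[OF linear_fderiv[OF smooth_on_differentiable[OF f that]], symmetric])
qed

section \<open>Symmetry of second derivatives and brackets\<close>

text \<open>The mean value theorem, applied once in each direction, turns the second difference over a
  parallelogram into a mixed second derivative at some point of it.\<close>

lemma second_difference_mvt:
  fixes f :: "'e::euclidean_space \<Rightarrow> real"
  assumes f: "Ck_on 2 S f" and t: "t > 0"
    and S: "\<And>r s. 0 \<le> r \<Longrightarrow> r \<le> t \<Longrightarrow> 0 \<le> s \<Longrightarrow> s \<le> t \<Longrightarrow> x + r *\<^sub>R u + s *\<^sub>R v \<in> S"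
  shows "\<exists>r s. 0 \<le> r \<and> r \<le> t \<and> 0 \<le> s \<and> s \<le> t \<and>
    f (x + t *\<^sub>R u + t *\<^sub>R v) - f (x + t *\<^sub>R u) - f (x + t *\<^sub>R v) + f x
       = t * t * fderiv (\<lambda>y. fderiv f y u) (x + r *\<^sub>R u + s *\<^sub>R v) v"
proof -
  have d1: "f differentiable (at y)" and d2: "(\<lambda>y. fderiv f y u) differentiable (at y)"
    if "y \<in> S" for y
    using f that by (simp_all add: numeral_2_eq_2)
  have der: "((\<lambda>r. G (y + r *\<^sub>R a)) has_derivative (\<lambda>h. h * fderiv G (y + r *\<^sub>R a) a)) (at r)"
    if "G differentiable (at (y + r *\<^sub>R a))" for G :: "'e \<Rightarrow> real" and y r a
  proof -
    have "((\<lambda>r. y + r *\<^sub>R a) has_derivative (\<lambda>h. h *\<^sub>R a)) (at r)"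
      by (auto intro!: derivative_eq_intros)
    from has_derivative_compose[OF this has_derivative_fderiv[OF that]]
    show ?thesis by (simp add: linear_cmul[OF linear_fderiv[OF that]])
  qed
  define p where "p r = f (x + t *\<^sub>R v + r *\<^sub>R u) - f (x + r *\<^sub>R u)" for r
  have "\<exists>r\<in>{0<..<t}. p t - p 0 =
     (t - 0) * fderiv f (x + t *\<^sub>R v + r *\<^sub>R u) u - (t - 0) * fderiv f (x + r *\<^sub>R u) u"
  proof (rule mvt_simple[OF t])
    fix r assume "0 \<le> r" "r \<le> t"
    then have "x + t *\<^sub>R v + r *\<^sub>R u \<in> S" "x + r *\<^sub>R u \<in> S"
      using S[of r t] S[of r 0] t by (simp_all add: algebra_simps)
    then show "(p has_derivative
        (\<lambda>h. h * fderiv f (x + t *\<^sub>R v + r *\<^sub>R u) u - h * fderiv f (x + r *\<^sub>R u) u)) (at r within {0..t})"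
      unfolding p_def
      by (intro has_derivative_diff has_derivative_at_withinI[OF der] d1)
  qed
  then obtain r where r: "0 < r" "r < t"
    and pr: "p t - p 0 = t * (fderiv f (x + r *\<^sub>R u + t *\<^sub>R v) u - fderiv f (x + r *\<^sub>R u) u)"
    by (auto simp: algebra_simps)
  define q where "q s = fderiv f (x + r *\<^sub>R u + s *\<^sub>R v) u" for s
  have "\<exists>s\<in>{0<..<t}. q t - q 0 = (t - 0) * fderiv (\<lambda>y. fderiv f y u) (x + r *\<^sub>R u + s *\<^sub>R v) v"
  proof (rule mvt_simple[OF t])
    fix s assume "0 \<le> s" "s \<le> t"
    then show "(q has_derivative
        (\<lambda>h. h * fderiv (\<lambda>y. fderiv f y u) (x + r *\<^sub>R u + s *\<^sub>R v) v)) (at s within {0..t})"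
      unfolding q_def using r
      by (intro has_derivative_at_withinI[OF der] d2 S) auto
  qed
  then obtain s where s: "0 < s" "s < t"
    "q t - q 0 = t * fderiv (\<lambda>y. fderiv f y u) (x + r *\<^sub>R u + s *\<^sub>R v) v" by auto
  have "p t - p 0 = t * t * fderiv (\<lambda>y. fderiv f y u) (x + r *\<^sub>R u + s *\<^sub>R v) v"
    using pr s(3) by (simp add: q_def)
  then have "f (x + t *\<^sub>R u + t *\<^sub>R v) - f (x + t *\<^sub>R u) - f (x + t *\<^sub>R v) + f x
       = t * t * fderiv (\<lambda>y. fderiv f y u) (x + r *\<^sub>R u + s *\<^sub>R v) v"
    by (simp add: p_def algebra_simps)
  then show ?thesis using r s by (meson less_imp_le)
qed

text \<open>The second difference does not change when \<open>u\<close> and \<open>v\<close> are swapped, so both mixed derivatives take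
  a common value (at possibly different points) in every small parallelogram at \<open>x\<close>.  If they differed at
  \<open>x\<close>, continuity would separate their values on a small ball.\<close>

lemma second_derivative_symmetric_real:
  fixes f :: "'e::euclidean_space \<Rightarrow> real"
  assumes S: "open S" "x \<in> S" and f: "Ck_on 2 S f"
  shows "fderiv (\<lambda>y. fderiv f y u) x v = fderiv (\<lambda>y. fderiv f y v) x u"
proof (rule ccontr)
  define P where "P y = fderiv (\<lambda>y. fderiv f y u) y v" for y
  define Q where "Q y = fderiv (\<lambda>y. fderiv f y v) y u" for y
  assume "\<not> ?thesis"
  then have ne: "P x \<noteq> Q x" by (simp add: P_def Q_def)
  define e where "e = dist (P x) (Q x) / 2"
  have e: "e > 0" using ne by (simp add: e_def)
  have "continuous_on S P" "continuous_on S Q"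
    using f by (simp_all add: numeral_2_eq_2 P_def[abs_def] Q_def[abs_def])
  then have cont: "isCont P x" "isCont Q x"
    using S by (simp_all add: continuous_on_eq_continuous_at)
  obtain d0 where d0: "d0 > 0" "ball x d0 \<subseteq> S" using S openE by blast
  obtain d1 where d1: "d1 > 0" "\<And>y. dist y x < d1 \<Longrightarrow> dist (P y) (P x) < e"
    using cont(1) e unfolding continuous_at_eps_delta by blast
  obtain d2 where d2: "d2 > 0" "\<And>y. dist y x < d2 \<Longrightarrow> dist (Q y) (Q x) < e"
    using cont(2) e unfolding continuous_at_eps_delta by blast
  define d where "d = min d0 (min d1 d2)"
  have d: "d > 0" using d0 d1 d2 by (simp add: d_def)
  define N where "N = norm u + norm v + 1"
  have N: "N > 0" unfolding N_def by (smt (verit) norm_ge_zero)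
  \<comment> \<open>side length for which the parallelogram stays inside the ball of radius \<open>d\<close>\<close>
  define t where "t = d / (2 * N)"
  have t: "t > 0" using d N by (simp add: t_def)
  have close: "dist (x + r *\<^sub>R u + s *\<^sub>R v) x < d"
    if "0 \<le> r" "r \<le> t" "0 \<le> s" "s \<le> t" for r s
  proof -
    have "dist (x + r *\<^sub>R u + s *\<^sub>R v) x \<le> r * norm u + s * norm v"
      using norm_triangle_ineq[of "r *\<^sub>R u" "s *\<^sub>R v"] that by (simp add: dist_norm add.assoc)
    also have "\<dots> \<le> t * norm u + t * norm v"
      using that by (intro add_mono mult_right_mono) auto
    also have "\<dots> \<le> t * N" using t by (simp add: N_def algebra_simps)
    also have "\<dots> = d / 2" using N by (simp add: t_def)
    finally show ?thesis using d by simp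
  qed
  have inS: "x + r *\<^sub>R u + s *\<^sub>R v \<in> S" if "0 \<le> r" "r \<le> t" "0 \<le> s" "s \<le> t" for r s
    using close[OF that] d0 by (auto simp: d_def dist_commute subset_iff)
  obtain r s where rs: "0 \<le> r" "r \<le> t" "0 \<le> s" "s \<le> t"
    "f (x + t *\<^sub>R u + t *\<^sub>R v) - f (x + t *\<^sub>R u) - f (x + t *\<^sub>R v) + f x
       = t * t * P (x + r *\<^sub>R u + s *\<^sub>R v)"
    using second_difference_mvt[OF f t, of x u v] inS unfolding P_def by blast
  have inS': "x + r *\<^sub>R v + s *\<^sub>R u \<in> S" if "0 \<le> r" "r \<le> t" "0 \<le> s" "s \<le> t" for r s
    using inS[of s r] that by (simp add: algebra_simps)
  obtain r' s' where rs': "0 \<le> r'" "r' \<le> t" "0 \<le> s'" "s' \<le> t"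
    "f (x + t *\<^sub>R v + t *\<^sub>R u) - f (x + t *\<^sub>R v) - f (x + t *\<^sub>R u) + f x
       = t * t * Q (x + r' *\<^sub>R v + s' *\<^sub>R u)"
    using second_difference_mvt[OF f t, of x v u] inS' unfolding Q_def by blast
  have comm: "x + t *\<^sub>R v + t *\<^sub>R u = x + t *\<^sub>R u + t *\<^sub>R v" by simp
  have "t * t * P (x + r *\<^sub>R u + s *\<^sub>R v) = t * t * Q (x + r' *\<^sub>R v + s' *\<^sub>R u)"
    using rs(5) rs'(5) unfolding comm by linarith
  then have "P (x + r *\<^sub>R u + s *\<^sub>R v) = Q (x + r' *\<^sub>R v + s' *\<^sub>R u)" using t by simp
  moreover have "dist (P (x + r *\<^sub>R u + s *\<^sub>R v)) (P x) < e"
    using close[OF rs(1-4)] by (intro d1(2)) (simp add: d_def)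
  moreover have "dist (Q (x + r' *\<^sub>R v + s' *\<^sub>R u)) (Q x) < e"
    using close[OF rs'(3,4,1,2)] by (intro d2(2)) (simp add: d_def algebra_simps)
  ultimately have "dist (P x) (Q x) < 2 * e"
    using dist_triangle[of "P x" "Q x" "P (x + r *\<^sub>R u + s *\<^sub>R v)"] by (simp add: dist_commute)
  then show False by (simp add: e_def)
qed

lemma second_derivative_symmetric:
  fixes f :: "'e::euclidean_space \<Rightarrow> 'f::euclidean_space"
  assumes S: "open S" "x \<in> S" and f: "Ck_on 2 S f"
  shows "fderiv (\<lambda>y. fderiv f y u) x v = fderiv (\<lambda>y. fderiv f y v) x u"
proof (rule euclidean_eqI)
  fix b :: 'f assume "b \<in> Basis"
  have inner: "fderiv (\<lambda>y. G y \<bullet> b) y v = fderiv G y v \<bullet> b"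
    if "G differentiable (at y)" for G :: "'e \<Rightarrow> 'f" and y v
    using fderiv_eq[OF has_derivative_inner_left[OF has_derivative_fderiv[OF that]]]
    by simp
  have fd: "f differentiable (at y)" and fd2: "(\<lambda>y. fderiv f y w) differentiable (at y)"
    if "y \<in> S" for y w
    using f that by (simp_all add: numeral_2_eq_2)
  have *: "fderiv (\<lambda>y. fderiv f y w) x z \<bullet> b = fderiv (\<lambda>y. fderiv (\<lambda>y. f y \<bullet> b) y w) x z" for w z
  proof -
    have "fderiv (\<lambda>y. fderiv (\<lambda>y. f y \<bullet> b) y w) x = fderiv (\<lambda>y. fderiv f y w \<bullet> b) x"
      by (rule fderiv_cong[OF S]) (simp add: inner fd)
    then show ?thesis by (simp add: inner fd2 S)
  qed
  show "fderiv (\<lambda>y. fderiv f y u) x v \<bullet> b = fderiv (\<lambda>y. fderiv f y v) x u \<bullet> b"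
    unfolding * by (rule second_derivative_symmetric_real[OF S Ck_on_inner[OF S(1) f]])
qed

text \<open>The product rule for a matrix-valued \<open>T\<close> acting on a vector-valued \<open>w\<close>, where \<open>T\<close> is known to be
  differentiable only entry by entry, that is on each fixed vector.\<close>

lemma has_derivative_linear_family:
  fixes T :: "'h::real_normed_vector \<Rightarrow> 'e::euclidean_space \<Rightarrow> 'f::real_normed_vector"
  assumes S: "open S" "x \<in> S" and lin: "\<And>y. y \<in> S \<Longrightarrow> linear (T y)"
    and T: "\<And>v. ((\<lambda>y. T y v) has_derivative T' v) (at x)"
    and w: "(w has_derivative w') (at x)"
  shows "((\<lambda>y. T y (w y)) has_derivative (\<lambda>h. T x (w' h) + T' (w x) h)) (at x)"
proof -
  have T'_eq: "T' v = (\<lambda>h. \<Sum>b\<in>Basis. (v \<bullet> b) *\<^sub>R T' b h)" for v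
  proof (rule has_derivative_unique[OF T])
    have "((\<lambda>y. \<Sum>b\<in>Basis. (v \<bullet> b) *\<^sub>R T y b) has_derivative (\<lambda>h. \<Sum>b\<in>Basis. (v \<bullet> b) *\<^sub>R T' b h)) (at x)"
      by (intro has_derivative_sum has_derivative_scaleR_right T)
    then show "((\<lambda>y. T y v) has_derivative (\<lambda>h. \<Sum>b\<in>Basis. (v \<bullet> b) *\<^sub>R T' b h)) (at x)"
      by (rule has_derivative_transform_within_open[OF _ S])
        (metis lin linear_eq_sum_Basis)
  qed
  have "((\<lambda>y. \<Sum>b\<in>Basis. (w y \<bullet> b) *\<^sub>R T y b) has_derivative
      (\<lambda>h. \<Sum>b\<in>Basis. (w x \<bullet> b) *\<^sub>R T' b h + (w' h \<bullet> b) *\<^sub>R T x b)) (at x)"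
    by (intro has_derivative_sum has_derivative_scaleR has_derivative_inner_left T w)
  moreover have "(\<Sum>b\<in>Basis. (w x \<bullet> b) *\<^sub>R T' b h + (w' h \<bullet> b) *\<^sub>R T x b)
      = T x (w' h) + T' (w x) h" for h
    using fun_cong[OF T'_eq[of "w x"], of h] linear_eq_sum_Basis[OF lin[OF S(2)], of "w' h"]
    by (simp add: sum.distrib)
  ultimately have "((\<lambda>y. \<Sum>b\<in>Basis. (w y \<bullet> b) *\<^sub>R T y b) has_derivative
      (\<lambda>h. T x (w' h) + T' (w x) h)) (at x)" by simp
  then show ?thesis
    by (rule has_derivative_transform_within_open[OF _ S]) (metis lin linear_eq_sum_Basis)
qed

text \<open>The coordinate form of the fact that a smooth map \<open>f\<close> respects Lie brackets: \<open>fderiv f y (a y)\<close> is the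
  image of the field \<open>a\<close>.  Differentiating the images produces the extra terms \<open>D\<^sup>2f(a, b)\<close> and
  \<open>D\<^sup>2f(b, a)\<close>, which cancel by symmetry.  With a transition map for \<open>f\<close> this says that the bracket does
  not depend on the chart; with an immersion it relates the bracket of a submanifold to the ambient
  connection.\<close>

lemma bracket_pushforward:
  fixes f :: "'e::euclidean_space \<Rightarrow> 'f::euclidean_space"
  assumes S: "open S" "x \<in> S" and f: "Ck_on 2 S f"
    and a: "a differentiable (at x)" and b: "b differentiable (at x)"
  shows "fderiv (\<lambda>y. fderiv f y (b y)) x (a x) - fderiv (\<lambda>y. fderiv f y (a y)) x (b x)
    = fderiv f x (fderiv b x (a x) - fderiv a x (b x))"
proof -
  have fd: "f differentiable (at y)" and fd2: "(\<lambda>y. fderiv f y v) differentiable (at y)"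
    if "y \<in> S" for y v
    using f that by (simp_all add: numeral_2_eq_2)
  have *: "fderiv (\<lambda>y. fderiv f y (c y)) x h
      = fderiv f x (fderiv c x h) + fderiv (\<lambda>y. fderiv f y (c x)) x h"
    if "c differentiable (at x)" for c h
    using fderiv_eq[OF has_derivative_linear_family[OF S, of "fderiv f"
          "\<lambda>v. fderiv (\<lambda>y. fderiv f y v) x" c, OF linear_fderiv[OF fd]
          has_derivative_fderiv[OF fd2[OF S(2)]] has_derivative_fderiv[OF that]]] by simp
  show ?thesis
    using second_derivative_symmetric[OF S f, of "b x" "a x"]
    by (simp add: *[OF a] *[OF b] linear_diff[OF linear_fderiv[OF fd[OF S(2)]]])
qed

section \<open>Bump functions\<close>

text \<open>The functions \<open>t\<^sup>-\<^sup>n e\<^sup>-\<^sup>1\<^sup>/\<^sup>t\<close>, extended by zero.  Keeping all \<open>n\<close> makes the family closed under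
  differentiation.\<close>

definition flat :: "nat \<Rightarrow> real \<Rightarrow> real" where
  "flat n t = (if t > 0 then inverse t ^ n / exp (inverse t) else 0)"

lemma flat_tendsto_0: "(flat n \<longlongrightarrow> 0) (at 0)"
proof (rule filterlim_split_at_real)
  show "(flat n \<longlongrightarrow> 0) (at_left 0)"
    by (rule tendsto_eventually) (auto simp: flat_def eventually_at_filter)
  have "((\<lambda>t::real. inverse t ^ n / exp (inverse t)) \<longlongrightarrow> 0) (at_right 0)"
    by (rule filterlim_compose[OF tendsto_power_div_exp_0 filterlim_inverse_at_top_right])
  then show "(flat n \<longlongrightarrow> 0) (at_right 0)"
    by (rule Lim_transform_eventually) (auto simp: flat_def eventually_at_filter)
qed

lemma flat_has_derivative:
  "(flat n has_real_derivative flat (n + 2) t - real n * flat (n + 1) t) (at t)"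
proof -
  consider "t < 0" | "t = 0" | "t > 0" by linarith
  then show ?thesis
  proof cases
    case 1
    have "((\<lambda>_. 0) has_real_derivative 0) (at t)" by simp
    then have "(flat n has_real_derivative 0) (at t)"
      by (rule has_field_derivative_transform_within_open[of _ _ _ "{..<0}"])
        (use 1 in \<open>auto simp: flat_def\<close>)
    then show ?thesis using 1 by (simp add: flat_def)
  next
    case 2
    have "((\<lambda>h. flat n h / h) \<longlongrightarrow> 0) (at 0)"
      by (rule Lim_transform_eventually[OF flat_tendsto_0[of "Suc n"]])
        (auto simp: flat_def eventually_at_filter field_simps)
    then show ?thesis using 2 by (simp add: has_field_derivative_iff flat_def)
  next
    case 3
    have "((\<lambda>t. inverse t ^ n / exp (inverse t)) has_real_derivative
        flat (n + 2) t - real n * flat (n + 1) t) (at t)"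
      using 3 by (cases n)
        (auto intro!: derivative_eq_intros simp: flat_def field_simps power2_eq_square,
          metis One_nat_def power_eq_if)
    then show ?thesis
      by (rule has_field_derivative_transform_within_open[of _ _ _ "{0<..}"])
        (use 3 in \<open>auto simp: flat_def\<close>)
  qed
qed

text \<open>Each derivative is a combination of two members of the family, and every member is continuous, so
  an induction over all \<open>n\<close> gives every order of differentiability at once.\<close>

lemma smooth_on_flat: "smooth_on S (flat n)"
proof -
  have "Ck_on k UNIV (flat n)" for k
  proof (induction k arbitrary: n)
    case 0
    show ?case
      using flat_has_derivative DERIV_isCont by (force intro!: continuous_at_imp_continuous_on)
  next
    case (Suc k)
    have hd: "(flat n has_derivative (\<lambda>v. (flat (n + 2) t + (- real n) * flat (n + 1) t) * v)) (at t)" for n t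
      using flat_has_derivative[of n t] by (simp add: has_field_derivative_def)
    have "Ck_on k UNIV (\<lambda>t. (flat (n + 2) t + (- real n) * flat (n + 1) t) * v)" for v
      by (intro Ck_on_bilinear[OF bounded_bilinear_mult] Ck_on_add Ck_on_const Suc.IH open_UNIV)
    moreover have "flat n differentiable (at t)" for t
      using differentiableI[OF hd] .
    ultimately show ?case by (simp add: fderiv_eq[OF hd])
  qed
  then show ?thesis unfolding smooth_on_def using Ck_on_subset by blast
qed

lemma flat_nonneg: "flat n t \<ge> 0"
  by (simp add: flat_def)

lemma flat_pos: "t > 0 \<Longrightarrow> flat n t > 0"
  by (simp add: flat_def)

lemma flat_nonpos_eq_0: "t \<le> 0 \<Longrightarrow> flat n t = 0"
  by (simp add: flat_def)

lemma smooth_on_inverse: "smooth_on {0<..} (inverse :: real \<Rightarrow> real)"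
proof -
  have "Ck_on k {0<..} (inverse :: real \<Rightarrow> real)" for k
  proof (induction k)
    case 0
    show ?case by (auto intro!: continuous_intros)
  next
    case (Suc k)
    have hd: "(inverse has_derivative (\<lambda>v. (-1 * (inverse t * inverse t)) * v)) (at t)"
      if "t > 0" for t :: real
      using that by (auto intro!: derivative_eq_intros)
    have "Ck_on k {0<..} (\<lambda>t. fderiv inverse t v)" for v :: real
    proof (rule Ck_on_cong)
      show "Ck_on k {0<..} (\<lambda>t. (-1 * (inverse t * inverse t)) * v)"
        by (intro Ck_on_bilinear[OF bounded_bilinear_mult] Ck_on_const Suc.IH open_greaterThan)
    qed (simp_all add: fderiv_eq[OF hd])
    then show ?case using differentiableI[OF hd] by simp
  qed
  then show ?thesis by (simp add: smooth_on_def)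
qed

lemma smooth_bump:
  fixes x0 :: "'e::euclidean_space"
  assumes r: "r > 0"
  obtains \<beta> :: "'e \<Rightarrow> real" where "smooth_on UNIV \<beta>"
    "\<And>x. x \<in> ball x0 r \<Longrightarrow> \<beta> x = 1" "\<And>x. x \<notin> ball x0 (2 * r) \<Longrightarrow> \<beta> x = 0"
proof -
  define n where "n x = (x - x0) \<bullet> (x - x0)" for x
  \<comment> \<open>the bump is \<open>p / m\<close>: \<open>p\<close> vanishes outside the large ball, and \<open>m\<close> agrees with \<open>p\<close> on the small one\<close>
  define p where "p x = flat 0 ((2 * r)^2 + -1 * n x)" for x
  define m where "m x = p x + flat 0 (- (r^2) + n x)" for x
  have lin: "smooth_on UNIV (\<lambda>x. x + (- x0))"
    by (intro smooth_on_add smooth_on_ident smooth_on_const open_UNIV)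
  have "smooth_on UNIV (\<lambda>x. (x + (- x0)) \<bullet> (x + (- x0)))"
    using lin unfolding smooth_on_def
    by (intro allI Ck_on_bilinear[OF bounded_bilinear_inner open_UNIV]) auto
  then have n: "smooth_on UNIV n" by (simp add: n_def[abs_def])
  have "smooth_on UNIV (\<lambda>x. (2 * r)^2 + -1 *\<^sub>R n x)" "smooth_on UNIV (\<lambda>x. - (r^2) + n x)"
    using n by (intro smooth_on_add smooth_on_scaleR smooth_on_const open_UNIV; assumption)+
  then have p: "smooth_on UNIV p" and "smooth_on UNIV (\<lambda>x. flat 0 (- (r^2) + n x))"
    unfolding p_def[abs_def]
    by (auto intro!: smooth_on_comp[OF open_UNIV _ _ smooth_on_flat[of UNIV]])
  then have m: "smooth_on UNIV m" unfolding m_def[abs_def] by (intro smooth_on_add open_UNIV)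
  have r2: "r^2 > 0" using r by (rule zero_less_power)
  have four: "(2 * r)^2 = 4 * r^2" by (simp add: power_mult_distrib)
  have m_pos: "m x > 0" for x
  proof (cases "n x < (2 * r)^2")
    case True
    then have "p x > 0" unfolding p_def by (intro flat_pos) linarith
    then show ?thesis using flat_nonneg[of 0 "- (r^2) + n x"] unfolding m_def by linarith
  next
    case False
    then have "- (r^2) + n x > 0" using r2 four by linarith
    then show ?thesis
      using flat_pos[of "- (r^2) + n x" 0] flat_nonneg[of 0 "(2 * r)^2 + -1 * n x"]
      unfolding m_def p_def by linarith
  qed
  have "smooth_on UNIV (\<lambda>x. p x *\<^sub>R inverse (m x))"
    using m_pos
    by (intro smooth_on_scaleR smooth_on_comp[OF _ _ m smooth_on_inverse] p open_UNIV) auto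
  moreover have n_dist: "n x = (dist x0 x)^2" for x
    unfolding n_def by (metis dist_commute dist_norm power2_norm_eq_inner)
  moreover have "p x *\<^sub>R inverse (m x) = 1" if "x \<in> ball x0 r" for x
  proof -
    have "n x \<le> r^2" using that r by (simp add: n_dist power_mono)
    then have "m x = p x" by (simp add: m_def flat_nonpos_eq_0)
    then show ?thesis using m_pos[of x] by simp
  qed
  moreover have "p x *\<^sub>R inverse (m x) = 0" if "x \<notin> ball x0 (2 * r)" for x
  proof -
    have "(2 * r)^2 \<le> n x" unfolding n_dist using that r by (intro power_mono) auto
    then show ?thesis by (simp add: p_def flat_nonpos_eq_0)
  qed
  ultimately show ?thesis using that[of "\<lambda>x. p x *\<^sub>R inverse (m x)"] by blast
qed

section \<open>Tangent vectors and fields in charts\<close>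

text \<open>The Jacobian at \<open>p\<close> of the change from chart \<open>c\<close> to chart \<open>d\<close>.\<close>

abbreviation chart_change :: "('a, 'e::euclidean_space) chart \<Rightarrow> ('a, 'f::euclidean_space) chart \<Rightarrow> 'a \<Rightarrow> 'e \<Rightarrow> 'f" where
  "chart_change c d p \<equiv> fderiv (snd d \<circ> chart_inv c) (snd c p)"

locale smooth_manifold =
  fixes A :: "('a::t2_space, 'e::euclidean_space) chart set"
  assumes atlas: "smooth_atlas A"
begin

lemma is_chart: "c \<in> A \<Longrightarrow> is_chart c"
  using atlas by (simp add: smooth_atlas_def)

lemma open_dom: "c \<in> A \<Longrightarrow> open (fst c)"
  using is_chart by (simp add: is_chart_def)

lemma chart_inv_coord: "c \<in> A \<Longrightarrow> p \<in> fst c \<Longrightarrow> chart_inv c (snd c p) = p"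
  using is_chart by (simp add: is_chart_def homeomorphism_def)

lemma chart_homeomorphism: "c \<in> A \<Longrightarrow> homeomorphism (fst c) (snd c ` fst c) (snd c) (chart_inv c)"
  using is_chart by (simp add: is_chart_def)

lemma open_coord_image:
  assumes "c \<in> A" "open V" shows "open (snd c ` (fst c \<inter> V))"
proof -
  have "openin (top_of_set (snd c ` fst c)) (snd c ` (fst c \<inter> V))"
    using assms by (intro homeomorphism_imp_open_map[OF chart_homeomorphism]) (auto simp: openin_open)
  then show ?thesis
    using is_chart[OF assms(1)] openin_open_trans by (auto simp: is_chart_def)
qed

lemma open_coord_vimage:
  assumes "c \<in> A" "open V" shows "open (fst c \<inter> snd c -` V)"
proof -
  have "continuous_on (fst c) (snd c)" using chart_homeomorphism[OF assms(1)] by (simp add: homeomorphism_def)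
  then show ?thesis using continuous_on_open_vimage[OF open_dom[OF assms(1)], of "snd c"] assms(2)
    by (simp add: Int_commute)
qed

lemma chart_at: "chart_at A p \<in> A" "p \<in> fst (chart_at A p)"
proof -
  have "p \<in> (\<Union>c\<in>A. fst c)" using atlas by (simp add: smooth_atlas_def)
  then have "\<exists>c. c \<in> A \<and> p \<in> fst c" by blast
  from someI_ex[OF this] show "chart_at A p \<in> A" "p \<in> fst (chart_at A p)"
    unfolding chart_at_def by auto
qed

lemma transition_image:
  "c \<in> A \<Longrightarrow> d \<in> A \<Longrightarrow>
     (snd c \<circ> chart_inv d) ` (snd d ` (fst d \<inter> fst c)) \<subseteq> snd c ` (fst c \<inter> fst d)"
  by (auto simp: chart_inv_coord)

lemma smooth_transition:
  "c \<in> A \<Longrightarrow> d \<in> A \<Longrightarrow> smooth_on (snd c ` (fst c \<inter> fst d)) (snd d \<circ> chart_inv c)"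
  using atlas by (simp add: smooth_atlas_def)

lemma transition_differentiable:
  "c \<in> A \<Longrightarrow> d \<in> A \<Longrightarrow> p \<in> fst c \<Longrightarrow> p \<in> fst d \<Longrightarrow>
     (snd d \<circ> chart_inv c) differentiable (at (snd c p))"
  using smooth_transition smooth_on_differentiable by blast

lemma linear_chart_change:
  "c \<in> A \<Longrightarrow> d \<in> A \<Longrightarrow> p \<in> fst c \<Longrightarrow> p \<in> fst d \<Longrightarrow> linear (chart_change c d p)"
  using transition_differentiable linear_fderiv by blast

text \<open>The chain rule for \<open>a \<circ> c\<^sup>-\<^sup>1 = (a \<circ> d\<^sup>-\<^sup>1) \<circ> (d \<circ> c\<^sup>-\<^sup>1)\<close>, valid near \<open>p\<close>.
  With \<open>a\<close> a third chart it yields the cocycle rule for Jacobians.\<close>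

lemma has_derivative_change_chart:
  assumes c: "c \<in> A" "p \<in> fst c" and d: "d \<in> A" "p \<in> fst d"
    and a: "(a \<circ> chart_inv d) differentiable (at (snd d p))"
  shows "((a \<circ> chart_inv c) has_derivative
      (\<lambda>v. fderiv (a \<circ> chart_inv d) (snd d p) (chart_change c d p v))) (at (snd c p))"
proof -
  have "(a \<circ> chart_inv d) differentiable (at ((snd d \<circ> chart_inv c) (snd c p)))"
    using a c d by (simp add: chart_inv_coord)
  from has_derivative_compose[OF has_derivative_fderiv[OF transition_differentiable[OF c(1) d(1) c(2) d(2)]]
      has_derivative_fderiv[OF this]]
  have "((\<lambda>y. (a \<circ> chart_inv d) ((snd d \<circ> chart_inv c) y)) has_derivative
      (\<lambda>v. fderiv (a \<circ> chart_inv d) (snd d p) (chart_change c d p v))) (at (snd c p))"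
    using c by (simp add: chart_inv_coord)
  then show ?thesis
    by (rule has_derivative_transform_within_open[of _ _ _ _ "snd c ` (fst c \<inter> fst d)"])
      (use c d in \<open>auto simp: chart_inv_coord intro: open_coord_image open_dom\<close>)
qed

lemmas fderiv_change_chart = fun_cong[OF fderiv_eq[OF has_derivative_change_chart]]

lemma chart_change_trans:
  assumes "c \<in> A" "p \<in> fst c" "d \<in> A" "p \<in> fst d" "e \<in> A" "p \<in> fst e"
  shows "chart_change d e p (chart_change c d p v) = chart_change c e p v"
  using assms by (simp add: fderiv_change_chart[of c p d "snd e"] transition_differentiable)

lemma chart_change_self:
  assumes "c \<in> A" "p \<in> fst c" shows "chart_change c c p v = v"
proof -
  have "fderiv (snd c \<circ> chart_inv c) (snd c p) = fderiv (\<lambda>y. y) (snd c p)"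
    using assms open_coord_image[OF assms(1) open_dom[OF assms(1)]]
    by (intro fderiv_cong[of "snd c ` fst c"]) (auto simp: chart_inv_coord)
  then show ?thesis by simp
qed

lemma components_eq: "components A c p = chart_change (chart_at A p) c p"
  by (simp add: components_def fun_eq_iff)

lemma linear_components: "c \<in> A \<Longrightarrow> p \<in> fst c \<Longrightarrow> linear (components A c p)"
  unfolding components_eq by (intro linear_chart_change chart_at)

lemma components_chart_at: "components A (chart_at A p) p v = v"
  unfolding components_eq by (intro chart_change_self chart_at)

lemma chart_change_components:
  "c \<in> A \<Longrightarrow> p \<in> fst c \<Longrightarrow> d \<in> A \<Longrightarrow> p \<in> fst d \<Longrightarrow>
     chart_change c d p (components A c p v) = components A d p v"
  unfolding components_eq by (intro chart_change_trans chart_at)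

lemma components_chart_change:
  "c \<in> A \<Longrightarrow> p \<in> fst c \<Longrightarrow> d \<in> A \<Longrightarrow> p \<in> fst d \<Longrightarrow>
     components A d p (chart_change c (chart_at A p) p v) = chart_change c d p v"
  unfolding components_eq by (intro chart_change_trans chart_at)

lemma chart_change_chart_at_components:
  "c \<in> A \<Longrightarrow> p \<in> fst c \<Longrightarrow> chart_change c (chart_at A p) p (components A c p v) = v"
  by (simp add: chart_change_components chart_at components_chart_at)

lemma components_inject:
  "c \<in> A \<Longrightarrow> p \<in> fst c \<Longrightarrow> components A c p v = components A c p w \<longleftrightarrow> v = w"
  by (metis chart_change_chart_at_components)

definition local_rep :: "('a, 'e) chart \<Rightarrow> ('a \<Rightarrow> 'e) \<Rightarrow> 'e \<Rightarrow> 'e" where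
  "local_rep c X = (\<lambda>p. components A c p (X p)) \<circ> chart_inv c"

lemma local_rep_coord:
  "c \<in> A \<Longrightarrow> p \<in> fst c \<Longrightarrow> local_rep c X (snd c p) = components A c p (X p)"
  by (simp add: local_rep_def chart_inv_coord)

lemma smooth_field_iff: "smooth_field A X \<longleftrightarrow> (\<forall>c\<in>A. smooth_on (snd c ` fst c) (local_rep c X))"
  by (simp add: smooth_field_on_def local_rep_def)

lemma local_rep_differentiable:
  "smooth_field A X \<Longrightarrow> c \<in> A \<Longrightarrow> p \<in> fst c \<Longrightarrow> local_rep c X differentiable (at (snd c p))"
  using smooth_on_differentiable unfolding smooth_field_iff by blast

text \<open>The definition evaluates the bracket at each point in the preferred chart there, which jumps with the
  point.  Since brackets are natural under transition maps, one fixed chart can be used for all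
  points of its domain, and smoothness of the bracket becomes visible.\<close>

lemma lie_bracket_in_chart:
  assumes X: "smooth_field A X" and Y: "smooth_field A Y" and c: "c \<in> A" "p \<in> fst c"
  shows "components A c p (lie_bracket A X Y p) =
    fderiv (local_rep c Y) (snd c p) (local_rep c X (snd c p))
    - fderiv (local_rep c X) (snd c p) (local_rep c Y (snd c p))"
proof -
  define d where "d = chart_at A p"
  have d: "d \<in> A" "p \<in> fst d" by (simp_all add: d_def chart_at)
  let ?S = "snd d ` (fst d \<inter> fst c)" and ?f = "snd c \<circ> chart_inv d"
  have S: "open ?S" "snd d p \<in> ?S" using c d by (auto intro: open_coord_image open_dom)
  have at_p: "local_rep d Z (snd d p) = Z p" for Z
    using local_rep_coord[OF d] components_chart_at by (simp add: d_def)
  have lie: "lie_bracket A X Y p = fderiv (local_rep d Y) (snd d p) (local_rep d X (snd d p))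
     - fderiv (local_rep d X) (snd d p) (local_rep d Y (snd d p))"
    unfolding lie_bracket_def dir_deriv_def at_p by (simp add: local_rep_def d_def)
  \<comment> \<open>the derivative of the components in \<open>c\<close>, computed in the chart \<open>d\<close> on the left and in \<open>c\<close> on the right\<close>
  have rep: "fderiv (\<lambda>y. fderiv ?f y (local_rep d Z y)) (snd d p) (local_rep d W (snd d p))
      = fderiv (local_rep c Z) (snd c p) (local_rep c W (snd c p))"
    if "smooth_field A Z" for Z W
  proof -
    let ?a = "\<lambda>q. components A c q (Z q)"
    have *: "fderiv (\<lambda>y. fderiv ?f y (local_rep d Z y)) (snd d p) = fderiv (?a \<circ> chart_inv d) (snd d p)"
      using c d by (intro fderiv_cong[OF S])
        (auto simp: local_rep_coord chart_inv_coord chart_change_components)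
    have "fderiv (?a \<circ> chart_inv d) (snd d p) (local_rep d W (snd d p))
        = fderiv (?a \<circ> chart_inv c) (snd c p) (chart_change d c p (local_rep d W (snd d p)))"
      using local_rep_differentiable[OF that c]
      by (intro fderiv_change_chart c d) (simp add: local_rep_def)
    then show ?thesis
      unfolding * using c d by (simp add: local_rep_coord chart_change_components flip: local_rep_def)
  qed
  have "components A c p (lie_bracket A X Y p) = chart_change d c p (lie_bracket A X Y p)"
    by (simp add: components_eq d_def)
  also have "\<dots> = fderiv (\<lambda>y. fderiv ?f y (local_rep d Y y)) (snd d p) (local_rep d X (snd d p))
      - fderiv (\<lambda>y. fderiv ?f y (local_rep d X y)) (snd d p) (local_rep d Y (snd d p))"
    unfolding lie
    by (intro bracket_pushforward[symmetric, OF S] smooth_on_Ck smooth_transition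
        local_rep_differentiable X Y c d)
  finally show ?thesis by (simp add: rep X Y)
qed

lemma smooth_field_lie_bracket:
  assumes X: "smooth_field A X" and Y: "smooth_field A Y"
  shows "smooth_field A (lie_bracket A X Y)"
  unfolding smooth_field_iff
proof
  fix c assume c: "c \<in> A"
  have op: "open (snd c ` fst c)" using open_coord_image[OF c open_UNIV] by simp
  have sm: "smooth_on (snd c ` fst c) (local_rep c X)" "smooth_on (snd c ` fst c) (local_rep c Y)"
    using X Y c by (simp_all add: smooth_field_iff)
  have "smooth_on (snd c ` fst c) (\<lambda>x. fderiv (local_rep c Y) x (local_rep c X x)
     + (-1) *\<^sub>R fderiv (local_rep c X) x (local_rep c Y x))"
    by (intro smooth_on_add smooth_on_scaleR smooth_on_const smooth_on_fderiv_apply sm op)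
  then show "smooth_on (snd c ` fst c) (local_rep c (lie_bracket A X Y))"
    by (rule smooth_on_cong[OF op, rotated])
      (use c in \<open>auto simp: local_rep_coord lie_bracket_in_chart[OF X Y]\<close>)
qed

lemma smooth_field_add:
  assumes "smooth_field A X" "smooth_field A Y" shows "smooth_field A (\<lambda>p. X p + Y p)"
  unfolding smooth_field_iff
proof
  fix c assume c: "c \<in> A"
  have op: "open (snd c ` fst c)" using open_coord_image[OF c open_UNIV] by simp
  have "smooth_on (snd c ` fst c) (\<lambda>x. local_rep c X x + local_rep c Y x)"
    using assms c op by (auto simp: smooth_field_iff intro: smooth_on_add)
  then show "smooth_on (snd c ` fst c) (local_rep c (\<lambda>p. X p + Y p))"
    by (rule smooth_on_cong[OF op, rotated])
      (use c in \<open>auto simp: local_rep_coord linear_add[OF linear_components]\<close>)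
qed

lemma smooth_field_scaleR:
  assumes "smooth_fun A a" "smooth_field A X" shows "smooth_field A (\<lambda>p. a p *\<^sub>R X p)"
  unfolding smooth_field_iff
proof
  fix c assume c: "c \<in> A"
  have op: "open (snd c ` fst c)" using open_coord_image[OF c open_UNIV] by simp
  have "smooth_on (snd c ` fst c) (\<lambda>x. (a \<circ> chart_inv c) x *\<^sub>R local_rep c X x)"
    using assms c op by (intro smooth_on_scaleR) (simp_all only: smooth_field_iff smooth_fun_def)
  then show "smooth_on (snd c ` fst c) (local_rep c (\<lambda>p. a p *\<^sub>R X p))"
    by (rule smooth_on_cong[OF op, rotated])
      (use c in \<open>auto simp: local_rep_coord chart_inv_coord linear_cmul[OF linear_components]\<close>)
qed

lemma smooth_field_zero: "smooth_field A (\<lambda>p. 0)"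
  unfolding smooth_field_iff
proof
  fix c assume c: "c \<in> A"
  have op: "open (snd c ` fst c)" using open_coord_image[OF c open_UNIV] by simp
  show "smooth_on (snd c ` fst c) (local_rep c (\<lambda>p. 0))"
    by (rule smooth_on_cong[OF op, of "\<lambda>x. 0"])
      (use c in \<open>auto simp: local_rep_coord linear_0[OF linear_components] smooth_on_const\<close>)
qed

lemma smooth_field_sum:
  "finite I \<Longrightarrow> (\<And>i. i \<in> I \<Longrightarrow> smooth_field A (X i)) \<Longrightarrow> smooth_field A (\<lambda>p. \<Sum>i\<in>I. X i p)"
  by (induction I rule: finite_induct) (auto intro: smooth_field_zero smooth_field_add)

subsection \<open>Extending local functions and fields\<close>

text \<open>The support \<open>K\<close> is the image of a closed ball, hence compact, hence closed because the manifold is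
  Hausdorff.  That is what makes extension by zero outside the chart smooth.\<close>

lemma chart_bump:
  assumes c: "c \<in> A" and q: "q \<in> fst c" and V: "open V" "q \<in> V"
  obtains \<beta> K U where "smooth_on UNIV \<beta>" "closed K" "K \<subseteq> fst c \<inter> V" "open U" "q \<in> U" "U \<subseteq> fst c"
    "\<And>p. p \<in> U \<Longrightarrow> \<beta> (snd c p) = (1::real)" "\<And>p. p \<in> fst c - K \<Longrightarrow> \<beta> (snd c p) = 0"
proof -
  define x0 where "x0 = snd c q"
  let ?I = "snd c ` (fst c \<inter> V)"
  have "open ?I" "x0 \<in> ?I" using c q V by (auto simp: x0_def intro: open_coord_image)
  then obtain e where e: "e > 0" "cball x0 e \<subseteq> ?I" using open_contains_cball by blast
  define r where "r = e / 2"
  have r: "r > 0" "2 * r = e" using e by (simp_all add: r_def)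
  from smooth_bump[OF r(1), of x0] obtain \<beta> where \<beta>: "smooth_on UNIV \<beta>"
    "\<And>x. x \<in> ball x0 r \<Longrightarrow> \<beta> x = (1::real)" "\<And>x. x \<notin> ball x0 e \<Longrightarrow> \<beta> x = 0"
    unfolding r(2) by blast
  define K where "K = chart_inv c ` cball x0 e"
  define U where "U = fst c \<inter> snd c -` ball x0 r"
  have "continuous_on (snd c ` fst c) (chart_inv c)"
    using chart_homeomorphism[OF c] by (simp add: homeomorphism_def)
  then have "continuous_on (cball x0 e) (chart_inv c)"
    by (rule continuous_on_subset) (use e(2) in blast)
  then have "closed K"
    unfolding K_def by (intro compact_imp_closed compact_continuous_image compact_cball)
  moreover have "K \<subseteq> fst c \<inter> V"
  proof
    fix p assume "p \<in> K"
    then obtain x where "x \<in> cball x0 e" "p = chart_inv c x" by (auto simp: K_def)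
    with e(2) obtain p' where "p' \<in> fst c \<inter> V" "p = chart_inv c (snd c p')" by blast
    then show "p \<in> fst c \<inter> V" using c by (simp add: chart_inv_coord)
  qed
  moreover have "open U" unfolding U_def using c by (intro open_coord_vimage) auto
  moreover have "q \<in> U" using q r by (simp add: U_def x0_def)
  moreover have "\<beta> (snd c p) = 0" if "p \<in> fst c - K" for p
  proof (rule \<beta>(3), rule notI)
    assume "snd c p \<in> ball x0 e"
    then have "chart_inv c (snd c p) \<in> K" by (simp add: K_def)
    then show False using that c by (simp add: chart_inv_coord)
  qed
  ultimately show ?thesis using that[of \<beta> K U] \<beta>(1,2) by (auto simp: U_def)
qed

text \<open>Multiply by a bump and extend by zero.  The constant \<open>f = 1\<close> gives bump functions supported in a
  prescribed open set \<open>V\<close>.\<close>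

lemma smooth_fun_extension:
  assumes c: "c \<in> A" and q: "q \<in> fst c" and V: "open V" "q \<in> V"
    and f: "smooth_on (snd c ` fst c) f"
  obtains a U where "smooth_fun A a" "open U" "q \<in> U" "U \<subseteq> fst c"
    "\<And>p. p \<in> U \<Longrightarrow> a p = f (snd c p)" "\<And>p. p \<notin> V \<Longrightarrow> a p = 0"
proof -
  obtain \<beta> K U where \<beta>: "smooth_on UNIV \<beta>" "closed K" "K \<subseteq> fst c \<inter> V" "open U" "q \<in> U" "U \<subseteq> fst c"
    "\<And>p. p \<in> U \<Longrightarrow> \<beta> (snd c p) = (1::real)" "\<And>p. p \<in> fst c - K \<Longrightarrow> \<beta> (snd c p) = 0"
    using chart_bump[OF c q V] by metis
  define a where "a p = (if p \<in> fst c then \<beta> (snd c p) *\<^sub>R f (snd c p) else 0)" for p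
  have op: "open (snd c ` fst c)" using open_coord_image[OF c open_UNIV] by simp
  have zero: "a p = 0" if "p \<notin> K" for p using that \<beta>(8) by (auto simp: a_def)
  have "smooth_fun A a"
    unfolding smooth_fun_def
  proof (intro ballI smooth_on_local)
    fix d x assume d: "d \<in> A" and "x \<in> snd d ` fst d"
    then obtain p where p: "p \<in> fst d" "x = snd d p" by auto
    show "\<exists>W. open W \<and> x \<in> W \<and> smooth_on W (a \<circ> chart_inv d)"
    proof (cases "p \<in> fst c")
      case True
      let ?W = "snd d ` (fst d \<inter> fst c)"
      have W: "open ?W" using c d open_coord_image open_dom by blast
      have "smooth_on (snd c ` fst c) (\<lambda>y. \<beta> y *\<^sub>R f y)"
        by (intro smooth_on_scaleR op f smooth_on_subset[OF \<beta>(1)]) simp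
      from smooth_on_comp[OF W order_trans[OF transition_image[OF c d] image_mono[OF Int_lower1]]
          smooth_transition[OF d c] this]
      have "smooth_on ?W (\<lambda>y. \<beta> ((snd c \<circ> chart_inv d) y) *\<^sub>R f ((snd c \<circ> chart_inv d) y))"
        .
      then have "smooth_on ?W (a \<circ> chart_inv d)"
        by (rule smooth_on_cong[OF W, rotated]) (use d in \<open>auto simp: a_def chart_inv_coord\<close>)
      then show ?thesis using W p True by blast
    next
      case False
      let ?W = "snd d ` (fst d \<inter> - K)"
      have W: "open ?W" using d \<beta>(2) open_coord_image by blast
      have "smooth_on ?W (a \<circ> chart_inv d)"
        by (rule smooth_on_cong[OF W, of "\<lambda>_. 0"])
          (use d zero in \<open>auto simp: chart_inv_coord smooth_on_const\<close>)
      then show ?thesis using W p False \<beta>(3) by blast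
    qed
  qed
  moreover have "a p = f (snd c p)" if "p \<in> U" for p using that \<beta> by (auto simp: a_def)
  moreover have "a p = 0" if "p \<notin> V" for p using that \<beta>(3) zero by auto
  ultimately show ?thesis using that \<beta> by metis
qed

lemma smooth_field_extension:
  assumes c: "c \<in> A" and q: "q \<in> fst c" and f: "smooth_on (snd c ` fst c) f"
  obtains X U where "smooth_field A X" "open U" "q \<in> U" "U \<subseteq> fst c"
    "\<And>p. p \<in> U \<Longrightarrow> components A c p (X p) = f (snd c p)"
proof -
  obtain \<beta> K U where \<beta>: "smooth_on UNIV \<beta>" "closed K" "K \<subseteq> fst c \<inter> UNIV" "open U" "q \<in> U" "U \<subseteq> fst c"
    "\<And>p. p \<in> U \<Longrightarrow> \<beta> (snd c p) = (1::real)" "\<And>p. p \<in> fst c - K \<Longrightarrow> \<beta> (snd c p) = 0"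
    using chart_bump[OF c q open_UNIV UNIV_I] by metis
  define X where
    "X p = (if p \<in> fst c then chart_change c (chart_at A p) p (\<beta> (snd c p) *\<^sub>R f (snd c p)) else 0)" for p
  have op: "open (snd c ` fst c)" using open_coord_image[OF c open_UNIV] by simp
  have zero: "X p = 0" if "p \<notin> K" for p
    using that \<beta>(8) linear_0[OF linear_chart_change[OF c chart_at(1) _ chart_at(2)]]
    by (auto simp: X_def)
  have "smooth_field A X"
    unfolding smooth_field_iff
  proof (intro ballI smooth_on_local)
    fix d x assume d: "d \<in> A" and "x \<in> snd d ` fst d"
    then obtain p where p: "p \<in> fst d" "x = snd d p" by auto
    show "\<exists>W. open W \<and> x \<in> W \<and> smooth_on W (local_rep d X)"
    proof (cases "p \<in> fst c")
      case True
      let ?W = "snd d ` (fst d \<inter> fst c)" and ?W' = "snd c ` (fst c \<inter> fst d)"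
      have W: "open ?W" "open ?W'" using c d open_coord_image open_dom by blast+
      have "smooth_on ?W' (\<lambda>y. \<beta> y *\<^sub>R f y)"
        by (intro smooth_on_scaleR W smooth_on_subset[OF f] smooth_on_subset[OF \<beta>(1)]) auto
      from smooth_on_comp[OF W(1) transition_image[OF c d] smooth_transition[OF d c]
          smooth_on_fderiv_apply[OF W(2) smooth_transition[OF c d] this]]
      have "smooth_on ?W (\<lambda>y. fderiv (snd d \<circ> chart_inv c) ((snd c \<circ> chart_inv d) y)
          (\<beta> ((snd c \<circ> chart_inv d) y) *\<^sub>R f ((snd c \<circ> chart_inv d) y)))"
        .
      then have "smooth_on ?W (local_rep d X)"
        by (rule smooth_on_cong[OF W(1), rotated])
          (use c d in \<open>auto simp: X_def local_rep_coord chart_inv_coord components_chart_change\<close>)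
      then show ?thesis using W p True by blast
    next
      case False
      let ?W = "snd d ` (fst d \<inter> - K)"
      have W: "open ?W" using d \<beta>(2) open_coord_image by blast
      have "smooth_on ?W (local_rep d X)"
        by (rule smooth_on_cong[OF W, of "\<lambda>_. 0"])
          (use d zero in \<open>auto simp: local_rep_coord linear_0[OF linear_components] smooth_on_const\<close>)
      then show ?thesis using W p False \<beta>(3) by blast
    qed
  qed
  moreover have "components A c p (X p) = f (snd c p)" if "p \<in> U" for p
  proof -
    have "p \<in> fst c" using that \<beta>(6) by blast
    then show ?thesis
      using that c \<beta>(7) by (simp add: X_def components_chart_change chart_change_self)
  qed
  ultimately show ?thesis using that \<beta> by metis
qed

text \<open>Local coordinate fields extend to global ones, so the choice operator in \<open>const_field\<close> does have a
  witness.\<close>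

lemma const_field:
  "smooth_field A (const_field A q w)"
  "\<exists>U. open U \<and> q \<in> U \<and> (\<forall>r\<in>U. components A (chart_at A q) r (const_field A q w r) = w)"
proof -
  have "\<exists>E. smooth_field A E \<and>
     (\<exists>U. open U \<and> q \<in> U \<and> (\<forall>r\<in>U. components A (chart_at A q) r (E r) = w))"
    using smooth_field_extension[OF chart_at(1) chart_at(2) smooth_on_const, of q w] by metis
  from someI_ex[OF this] show "smooth_field A (const_field A q w)"
    "\<exists>U. open U \<and> q \<in> U \<and> (\<forall>r\<in>U. components A (chart_at A q) r (const_field A q w r) = w)"
    unfolding const_field_def by auto
qed

lemma const_field_at: "const_field A q w q = w"
  using const_field(2)[of q w] components_chart_at by metis

lemma dir_deriv_cong:
  assumes "open U" "p \<in> U" "\<And>r. r \<in> U \<Longrightarrow> a r = b r"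
  shows "dir_deriv A a p v = dir_deriv A b p v"
proof -
  let ?c = "chart_at A p"
  have "fderiv (a \<circ> chart_inv ?c) (snd ?c p) = fderiv (b \<circ> chart_inv ?c) (snd ?c p)"
  proof (rule fderiv_cong)
    show "open (snd ?c ` (fst ?c \<inter> U))" using open_coord_image[OF chart_at(1) assms(1)] .
    show "snd ?c p \<in> snd ?c ` (fst ?c \<inter> U)" using assms(2) chart_at(2) by blast
  qed (use assms(3) chart_inv_coord[OF chart_at(1)] in auto)
  then show ?thesis by (simp add: dir_deriv_def)
qed

lemma dir_deriv_const: "dir_deriv A (\<lambda>r. k) p v = 0"
  by (simp add: dir_deriv_def comp_def)

lemma dir_deriv_const_field:
  "dir_deriv A (\<lambda>r. components A (chart_at A q) r (const_field A q w r)) q v = 0"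
proof -
  obtain U where U: "open U" "q \<in> U"
    "\<And>r. r \<in> U \<Longrightarrow> components A (chart_at A q) r (const_field A q w r) = w"
    using const_field(2)[of q w] by blast
  have "dir_deriv A (\<lambda>r. components A (chart_at A q) r (const_field A q w r)) q v
      = dir_deriv A (\<lambda>r. w) q v"
    by (rule dir_deriv_cong[OF U(1,2)]) (rule U(3))
  then show ?thesis by (simp add: dir_deriv_const)
qed

lemma lie_bracket_const_field: "lie_bracket A (const_field A q v) (const_field A q w) q = 0"
  by (simp add: lie_bracket_def dir_deriv_const_field)

end

section \<open>Connections are local and determined by coordinate fields\<close>

locale affine_manifold = smooth_manifold A
  for A :: "('a::t2_space, 'e::euclidean_space) chart set" +
  fixes nabla :: "('a \<Rightarrow> 'e) \<Rightarrow> ('a \<Rightarrow> 'e) \<Rightarrow> 'a \<Rightarrow> 'e"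
  assumes connection: "affine_connection A nabla"
begin

lemma nabla_add:
  "smooth_field A X \<Longrightarrow> smooth_field A Y \<Longrightarrow> smooth_field A Z \<Longrightarrow>
     nabla X (\<lambda>p. Y p + Z p) q = nabla X Y q + nabla X Z q"
  using connection unfolding affine_connection_def by simp

lemma nabla_leibniz:
  "smooth_fun A a \<Longrightarrow> smooth_field A X \<Longrightarrow> smooth_field A Y \<Longrightarrow>
     nabla X (\<lambda>p. a p *\<^sub>R Y p) q = dir_deriv A a q (X q) *\<^sub>R Y q + a q *\<^sub>R nabla X Y q"
  using connection unfolding affine_connection_def by simp

lemma nabla_zero: "smooth_field A X \<Longrightarrow> nabla X (\<lambda>p. 0) q = 0"
  using nabla_add[OF _ smooth_field_zero smooth_field_zero, of X q] by simp

lemma nabla_sum: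
  "finite I \<Longrightarrow> smooth_field A X \<Longrightarrow> (\<And>i. i \<in> I \<Longrightarrow> smooth_field A (Y i)) \<Longrightarrow>
     nabla X (\<lambda>p. \<Sum>i\<in>I. Y i p) q = (\<Sum>i\<in>I. nabla X (Y i) q)"
  by (induction I rule: finite_induct) (simp_all add: nabla_zero nabla_add smooth_field_sum)

text \<open>A connection is given on global fields only, so its locality has to be derived: for a bump \<open>a\<close> at
  \<open>q\<close> supported where \<open>Y = Z\<close>, the fields \<open>aY\<close> and \<open>aZ\<close> coincide, and the Leibniz rule at \<open>q\<close> compares
  \<open>\<nabla>\<^sub>XY\<close> with \<open>\<nabla>\<^sub>XZ\<close>.\<close>

lemma nabla_local:
  assumes X: "smooth_field A X" and Y: "smooth_field A Y" and Z: "smooth_field A Z"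
    and U: "open U" "q \<in> U" "\<And>p. p \<in> U \<Longrightarrow> Y p = Z p"
  shows "nabla X Y q = nabla X Z q"
proof -
  obtain a W where a: "smooth_fun A a" "q \<in> W" "\<And>p. p \<in> W \<Longrightarrow> a p = 1"
    "\<And>p. p \<notin> U \<Longrightarrow> a p = 0"
    using smooth_fun_extension[OF chart_at(1) chart_at(2) U(1,2) smooth_on_const, of 1] by metis
  have "(\<lambda>p. a p *\<^sub>R Y p) = (\<lambda>p. a p *\<^sub>R Z p)"
    using a(4) U(3) by (intro ext) (metis scaleR_zero_left)
  then have "nabla X (\<lambda>p. a p *\<^sub>R Y p) q = nabla X (\<lambda>p. a p *\<^sub>R Z p) q" by (rule arg_cong)
  then show ?thesis
    using a U by (simp add: nabla_leibniz X Y Z)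
qed

text \<open>The formula \<open>\<nabla>\<^sub>XY = X(Y\<^sup>b) \<partial>\<^sub>b + Y\<^sup>b \<nabla>\<^sub>X \<partial>\<^sub>b\<close> at \<open>q\<close>: near \<open>q\<close> the field is the combination of the global
  extensions of the coordinate fields with coefficients extended to global functions, and locality
  allows replacing it.\<close>

lemma nabla_coordinates:
  assumes X: "smooth_field A X" and Y: "smooth_field A Y"
  shows "nabla X Y q = dir_deriv A (\<lambda>r. components A (chart_at A q) r (Y r)) q (X q)
    + (\<Sum>b\<in>Basis. (Y q \<bullet> b) *\<^sub>R nabla X (const_field A q b) q)"
proof -
  define c where "c = chart_at A q"
  have c: "c \<in> A" "q \<in> fst c" by (simp_all add: c_def chart_at)
  have op: "open (snd c ` fst c)" using open_coord_image[OF c(1) open_UNIV] by simp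
  have Yc: "smooth_on (snd c ` fst c) (local_rep c Y)" using Y c by (simp add: smooth_field_iff)
  have "\<exists>a U. smooth_fun A a \<and> open U \<and> q \<in> U \<and> U \<subseteq> fst c \<and>
     (\<forall>p\<in>U. a p = local_rep c Y (snd c p) \<bullet> b)" for b
    by (rule smooth_fun_extension[OF c open_UNIV UNIV_I smooth_on_inner[OF op Yc, of b]]) blast
  then obtain a U where a: "\<And>b. smooth_fun A (a b)" and U: "\<And>b. open (U b)" "\<And>b. q \<in> U b"
    "\<And>b. U b \<subseteq> fst c" "\<And>b p. p \<in> U b \<Longrightarrow> a b p = local_rep c Y (snd c p) \<bullet> b"
    by metis
  obtain V where V: "\<And>b. open (V b)" "\<And>b. q \<in> V b"
    "\<And>b p. p \<in> V b \<Longrightarrow> components A c p (const_field A q b p) = b"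
    using const_field(2)[of q] unfolding c_def by metis
  define N where "N = fst c \<inter> (\<Inter>b\<in>Basis. U b \<inter> V b)"
  have N: "open N" "q \<in> N"
    unfolding N_def using U V c by (auto intro!: open_Int open_INT open_dom)
  have a_eq: "a b p = components A c p (Y p) \<bullet> b" if "p \<in> U b" for b p
    using U(3)[of b] U(4)[OF that] that c by (auto simp: local_rep_coord)
  \<comment> \<open>on \<open>N\<close> the field \<open>Y\<close> is the sum of these global fields\<close>
  let ?E = "\<lambda>b p. a b p *\<^sub>R const_field A q b p"
  have E: "smooth_field A (?E b)" for b by (intro smooth_field_scaleR a const_field)
  have "nabla X Y q = nabla X (\<lambda>p. \<Sum>b\<in>Basis. ?E b p) q"
  proof (rule nabla_local[OF X Y _ N])
    show "smooth_field A (\<lambda>p. \<Sum>b\<in>Basis. ?E b p)" by (intro smooth_field_sum E) auto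
    fix p assume p: "p \<in> N"
    then have pc: "p \<in> fst c" by (simp add: N_def)
    have "components A c p (\<Sum>b\<in>Basis. ?E b p)
        = (\<Sum>b\<in>Basis. (components A c p (Y p) \<bullet> b) *\<^sub>R b)"
      using p V(3) a_eq
      by (simp add: N_def linear_sum[OF linear_components[OF c(1) pc]]
          linear_cmul[OF linear_components[OF c(1) pc]])
    also have "\<dots> = components A c p (Y p)" by (rule euclidean_representation)
    finally show "Y p = (\<Sum>b\<in>Basis. ?E b p)" using components_inject[OF c(1) pc] by metis
  qed
  also have "\<dots> = (\<Sum>b\<in>Basis. nabla X (?E b) q)" by (intro nabla_sum X E) auto
  also have "\<dots> = (\<Sum>b\<in>Basis. dir_deriv A (a b) q (X q) *\<^sub>R b
      + (Y q \<bullet> b) *\<^sub>R nabla X (const_field A q b) q)"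
  proof (rule sum.cong)
    fix b
    have "a b q = Y q \<bullet> b" using a_eq[OF U(2)] components_chart_at by (simp add: c_def)
    then show "nabla X (?E b) q = dir_deriv A (a b) q (X q) *\<^sub>R b
        + (Y q \<bullet> b) *\<^sub>R nabla X (const_field A q b) q"
      by (simp add: nabla_leibniz a X const_field const_field_at)
  qed simp
  also have "(\<lambda>b. dir_deriv A (a b) q (X q) *\<^sub>R b)
      = (\<lambda>b. (dir_deriv A (\<lambda>r. components A c r (Y r)) q (X q) \<bullet> b) *\<^sub>R b)"
  proof
    fix b
    have "dir_deriv A (a b) q (X q) = dir_deriv A (\<lambda>r. components A c r (Y r) \<bullet> b) q (X q)"
      by (rule dir_deriv_cong[OF U(1,2) a_eq])
    also have "\<dots> = fderiv (\<lambda>x. local_rep c Y x \<bullet> b) (snd c q) (X q)"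
      by (simp add: dir_deriv_def local_rep_def comp_def flip: c_def)
    also have "\<dots> = fderiv (local_rep c Y) (snd c q) (X q) \<bullet> b"
      using fderiv_eq[OF has_derivative_inner_left[OF has_derivative_fderiv[OF
              local_rep_differentiable[OF Y c]]]] by simp
    finally show "dir_deriv A (a b) q (X q) *\<^sub>R b
        = (dir_deriv A (\<lambda>r. components A c r (Y r)) q (X q) \<bullet> b) *\<^sub>R b"
      by (simp add: dir_deriv_def local_rep_def flip: c_def)
  qed
  finally show ?thesis
    by (simp add: sum.distrib euclidean_representation c_def)
qed

text \<open>The Christoffel sum in the coordinate formula is itself the derivative of the field with
  constant components \<open>Y q\<close>, since those components have derivative zero.\<close>

lemma nabla_eq_const_field:
  assumes X: "smooth_field A X" and Y: "smooth_field A Y"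
  shows "nabla X Y q = dir_deriv A (\<lambda>r. components A (chart_at A q) r (Y r)) q (X q)
    + nabla X (const_field A q (Y q)) q"
  using nabla_coordinates[OF X Y] nabla_coordinates[OF X const_field(1)[of q "Y q"], of q]
  by (simp add: dir_deriv_const_field const_field_at)

end

section \<open>Differentiating fields along a map\<close>

locale smooth_mapping = M: smooth_manifold A + N: smooth_manifold B
  for A :: "('a::t2_space, 'e::euclidean_space) chart set"
    and B :: "('b::t2_space, 'f::euclidean_space) chart set" +
  fixes F :: "'a \<Rightarrow> 'b"
  assumes smooth_map: "smooth_map A B F"
begin

lemma open_preimage: "open V \<Longrightarrow> open (F -` V)"
  using smooth_map unfolding smooth_map_def by (simp add: continuous_on_open_vimage)

lemma smooth_coordinate_map:
  "c \<in> A \<Longrightarrow> d \<in> B \<Longrightarrow> smooth_on (snd c ` (fst c \<inter> F -` fst d)) (snd d \<circ> F \<circ> chart_inv c)"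
  using smooth_map by (simp add: smooth_map_def)

lemma coordinate_map_differentiable:
  "c \<in> A \<Longrightarrow> p \<in> fst c \<Longrightarrow> d \<in> B \<Longrightarrow> F p \<in> fst d \<Longrightarrow>
     (snd d \<circ> F \<circ> chart_inv c) differentiable (at (snd c p))"
  by (rule smooth_on_differentiable[OF smooth_coordinate_map]) auto

lemma has_derivative_along:
  assumes c: "c \<in> A" "p \<in> fst c" and d: "d \<in> B" "F p \<in> fst d"
    and b: "(b \<circ> chart_inv d) differentiable (at (snd d (F p)))"
  shows "((b \<circ> F \<circ> chart_inv c) has_derivative
      (\<lambda>v. fderiv (b \<circ> chart_inv d) (snd d (F p)) (fderiv (snd d \<circ> F \<circ> chart_inv c) (snd c p) v)))
      (at (snd c p))"
proof -
  have "(b \<circ> chart_inv d) differentiable (at ((snd d \<circ> F \<circ> chart_inv c) (snd c p)))"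
    using b c by (simp add: M.chart_inv_coord)
  from has_derivative_compose[OF has_derivative_fderiv[OF coordinate_map_differentiable[OF c d]]
      has_derivative_fderiv[OF this]]
  have "((\<lambda>y. (b \<circ> chart_inv d) ((snd d \<circ> F \<circ> chart_inv c) y)) has_derivative
      (\<lambda>v. fderiv (b \<circ> chart_inv d) (snd d (F p)) (fderiv (snd d \<circ> F \<circ> chart_inv c) (snd c p) v)))
      (at (snd c p))"
    using c by (simp add: M.chart_inv_coord)
  moreover have "open (snd c ` (fst c \<inter> F -` fst d))"
    using c d by (intro M.open_coord_image open_preimage N.open_dom)
  ultimately show ?thesis
    by (rule has_derivative_transform_within_open)
      (use c d in \<open>auto simp: M.chart_inv_coord N.chart_inv_coord\<close>)
qed

lemma differential_eq:
  "differential A B F p =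
     fderiv (snd (chart_at B (F p)) \<circ> F \<circ> chart_inv (chart_at A p)) (snd (chart_at A p) p)"
  by (simp add: fun_eq_iff differential_def dir_deriv_def)

lemma linear_differential: "linear (differential A B F p)"
  unfolding differential_eq
  by (intro linear_fderiv coordinate_map_differentiable M.chart_at N.chart_at)

text \<open>Lets the differential, defined by the preferred charts at \<open>p\<close> and \<open>F p\<close>, be computed in any pair of
  charts, so that it can be differentiated as \<open>p\<close> varies.\<close>

lemma components_differential:
  assumes c: "c \<in> A" "p \<in> fst c" and d: "d \<in> B" "F p \<in> fst d"
  shows "components B d (F p) (differential A B F p v)
    = fderiv (snd d \<circ> F \<circ> chart_inv c) (snd c p) (components A c p v)"
proof -
  have "components B d (F p) (differential A B F p v)
      = fderiv (snd d \<circ> F \<circ> chart_inv (chart_at A p)) (snd (chart_at A p) p) v"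
    unfolding N.components_eq differential_eq
    using fderiv_eq[OF has_derivative_along[OF M.chart_at N.chart_at
          N.transition_differentiable[OF N.chart_at(1) d(1) N.chart_at(2) d(2)]]] by simp
  also have "\<dots> = fderiv (snd d \<circ> F \<circ> chart_inv c) (snd c p) (components A c p v)"
    unfolding M.components_eq
    by (rule M.fderiv_change_chart[OF M.chart_at c coordinate_map_differentiable[OF c d]])
  finally show ?thesis .
qed

lemma open_coordinate_dom:
  "c \<in> A \<Longrightarrow> d \<in> B \<Longrightarrow> open (snd c ` (fst c \<inter> F -` fst d))"
  by (intro M.open_coord_image open_preimage N.open_dom)

lemma components_push_field:
  assumes c: "c \<in> A" and d: "d \<in> B" and y: "y \<in> snd c ` (fst c \<inter> F -` fst d)"
  shows "components B d (F (chart_inv c y)) (push_field A B F Y (chart_inv c y))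
    = fderiv (snd d \<circ> F \<circ> chart_inv c) y (M.local_rep c Y y)"
  using y c d by (auto simp: push_field_def M.chart_inv_coord components_differential M.local_rep_coord)

lemma push_field_differentiable:
  assumes Y: "smooth_field A Y" and c: "c \<in> A" "p \<in> fst c" and d: "d \<in> B" "F p \<in> fst d"
  shows "((\<lambda>r. components B d (F r) (push_field A B F Y r)) \<circ> chart_inv c) differentiable (at (snd c p))"
proof (rule smooth_on_differentiable)
  let ?S = "snd c ` (fst c \<inter> F -` fst d)"
  have op: "open ?S" using c d by (intro open_coordinate_dom)
  have "smooth_on ?S (M.local_rep c Y)"
    by (rule smooth_on_subset[of "snd c ` fst c"]) (use Y c in \<open>auto simp: M.smooth_field_iff\<close>)
  then have "smooth_on ?S (\<lambda>y. fderiv (snd d \<circ> F \<circ> chart_inv c) y (M.local_rep c Y y))"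
    using c d by (intro smooth_on_fderiv_apply op smooth_coordinate_map)
  then show "smooth_on ?S ((\<lambda>r. components B d (F r) (push_field A B F Y r)) \<circ> chart_inv c)"
    by (rule smooth_on_cong[OF op, rotated]) (simp only: comp_apply components_push_field c d)
  show "snd c p \<in> ?S" using c d by blast
qed

text \<open>The pulled-back connection inherits torsion-freeness.  The Christoffel terms of the two
  derivatives cancel, since coordinate fields have bracket zero and the connection is torsion-free; what remains is the
  coordinate identity for brackets of images under \<open>F\<close>.\<close>

lemma connection_along_torsion_free:
  assumes tf: "torsion_free B nabla" and X: "smooth_field A X" and Y: "smooth_field A Y"
  shows "connection_along A B F nabla X (push_field A B F Y) p
    - connection_along A B F nabla Y (push_field A B F X) p
    = differential A B F p (lie_bracket A X Y p)"
proof -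
  define c where "c = chart_at A p"
  define d where "d = chart_at B (F p)"
  have c: "c \<in> A" "p \<in> fst c" and d: "d \<in> B" "F p \<in> fst d"
    by (simp_all add: c_def d_def M.chart_at N.chart_at)
  let ?S = "snd c ` (fst c \<inter> F -` fst d)" and ?f = "snd d \<circ> F \<circ> chart_inv c"
  have S: "open ?S" "snd c p \<in> ?S" using c d open_coordinate_dom by auto
  have at_p: "M.local_rep c Z (snd c p) = Z p" for Z
    using M.local_rep_coord[OF c] M.components_chart_at by (simp add: c_def)
  have D: "dir_deriv A (\<lambda>r. components B d (F r) (push_field A B F Z r)) p (V p)
      = fderiv (\<lambda>y. fderiv ?f y (M.local_rep c Z y)) (snd c p) (M.local_rep c V (snd c p))" for Z V
  proof -
    have "fderiv ((\<lambda>r. components B d (F r) (push_field A B F Z r)) \<circ> chart_inv c) (snd c p)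
        = fderiv (\<lambda>y. fderiv ?f y (M.local_rep c Z y)) (snd c p)"
      by (rule fderiv_cong[OF S]) (simp only: comp_apply components_push_field c d)
    then show ?thesis by (simp add: dir_deriv_def at_p flip: c_def)
  qed
  let ?E = "\<lambda>Z. const_field B (F p) (push_field A B F Z p)"
  have christoffel: "nabla (?E X) (?E Y) (F p) - nabla (?E Y) (?E X) (F p) = 0"
    using tf N.const_field(1) N.lie_bracket_const_field unfolding torsion_free_def by metis
  have "connection_along A B F nabla X (push_field A B F Y) p
      - connection_along A B F nabla Y (push_field A B F X) p
      = fderiv (\<lambda>y. fderiv ?f y (M.local_rep c Y y)) (snd c p) (M.local_rep c X (snd c p))
      - fderiv (\<lambda>y. fderiv ?f y (M.local_rep c X y)) (snd c p) (M.local_rep c Y (snd c p))"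
    using christoffel D[of Y X] D[of X Y] by (simp add: connection_along_def flip: d_def)
  also have "\<dots> = fderiv ?f (snd c p) (fderiv (M.local_rep c Y) (snd c p) (M.local_rep c X (snd c p))
      - fderiv (M.local_rep c X) (snd c p) (M.local_rep c Y (snd c p)))"
    by (intro bracket_pushforward[OF S] smooth_on_Ck smooth_coordinate_map
        M.local_rep_differentiable X Y c d)
  also have "\<dots> = fderiv ?f (snd c p) (lie_bracket A X Y p)"
    using M.lie_bracket_in_chart[OF X Y c] M.components_chart_at by (simp add: c_def)
  finally show ?thesis by (simp add: differential_eq c_def d_def)
qed

text \<open>The gauge equation, given for fields on the ambient manifold, carries over to fields along \<open>F\<close>, which
  need not extend to the ambient manifold.  In the chart at \<open>F p\<close> the left side differentiates a product of
  the matrix of \<open>\<Theta>\<close> with the components of \<open>W\<close>.  One term is \<open>\<Theta>\<close> applied to the derivative of \<open>W\<close>; the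
  derivative of the matrix combines with the Christoffel term of \<open>\<nabla>\<close> to \<open>\<nabla>(\<Theta>E)\<close>, where \<open>E\<close> has the
  constant components \<open>W p\<close>, and there the gauge equation applies.\<close>

lemma connection_along_tensor:
  assumes nabla: "affine_connection B nabla" and \<Theta>: "tensor11_field B \<Theta>"
    and gauge: "\<And>X Y q. smooth_field B X \<Longrightarrow> smooth_field B Y \<Longrightarrow>
      nabla X (\<lambda>r. \<Theta> r (Y r)) q = \<Theta> q (nabla' X Y q)"
    and W: "((\<lambda>r. components B (chart_at B (F p)) (F r) (W r)) \<circ> chart_inv (chart_at A p))
      differentiable (at (snd (chart_at A p) p))"
  shows "connection_along A B F nabla X (\<lambda>r. \<Theta> (F r) (W r)) p
    = \<Theta> (F p) (connection_along A B F nabla' X W p)"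
proof -
  interpret affine_manifold B nabla by unfold_locales (rule nabla)
  define q where "q = F p"
  define c where "c = chart_at A p"
  define d where "d = chart_at B q"
  have c: "c \<in> A" "p \<in> fst c" and d: "d \<in> B" "q \<in> fst d"
    by (simp_all add: c_def d_def M.chart_at N.chart_at)
  have lin: "linear (\<Theta> r)" for r using \<Theta> by (simp add: tensor11_field_def)
  have smooth\<Theta>: "smooth_field B (\<lambda>r. \<Theta> r (E r))" if "smooth_field B E" for E
    using \<Theta> that by (simp add: tensor11_field_def)
  let ?E = "\<lambda>v. const_field B q v"
  define w where "w = (\<lambda>r. components B d (F r) (W r)) \<circ> chart_inv c"
  \<comment> \<open>the matrix of \<open>\<Theta>\<close> at \<open>s\<close> in the fixed chart \<open>d\<close>\<close>
  define \<theta> where "\<theta> s v = components B d s (\<Theta> s (chart_change d (chart_at B s) s v))" for s v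
  have \<theta>_components: "\<theta> s (components B d s v) = components B d s (\<Theta> s v)" if "s \<in> fst d" for s v
    using d that by (simp add: \<theta>_def N.chart_change_chart_at_components)
  have lin_\<theta>: "linear (\<theta> s)" if "s \<in> fst d" for s
    unfolding \<theta>_def[abs_def]
    using linear_compose[OF linear_compose[OF N.linear_chart_change[OF d(1) N.chart_at(1) that N.chart_at(2)] lin]
        N.linear_components[OF d(1) that]] by (simp add: comp_def)
  have \<theta>_q: "\<theta> q v = \<Theta> q v" for v
    using \<theta>_components[OF d(2), of v] N.components_chart_at by (simp add: d_def)
  have \<theta>_field: "\<exists>U. open U \<and> q \<in> U \<and> U \<subseteq> fst d \<and> (\<forall>s\<in>U. \<theta> s v = components B d s (\<Theta> s (?E v s)))" for v
  proof -
    obtain U where U: "open U" "q \<in> U" "\<And>s. s \<in> U \<Longrightarrow> components B d s (?E v s) = v"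
      using N.const_field(2)[of q v] unfolding d_def by blast
    have "\<theta> s v = components B d s (\<Theta> s (?E v s))" if "s \<in> U \<inter> fst d" for s
      using \<theta>_components[of s "?E v s"] U(3)[of s] that by simp
    then show ?thesis using U d N.open_dom[OF d(1)] by (intro exI[of _ "U \<inter> fst d"]) auto
  qed
  have dir_\<theta>: "dir_deriv B (\<lambda>s. \<theta> s v) q u = dir_deriv B (\<lambda>s. components B d s (\<Theta> s (?E v s))) q u" for v u
  proof -
    obtain U where U: "open U" "q \<in> U" "\<And>s. s \<in> U \<Longrightarrow> \<theta> s v = components B d s (\<Theta> s (?E v s))"
      using \<theta>_field[of v] by blast
    show ?thesis by (rule N.dir_deriv_cong[OF U(1,2)]) (rule U(3))
  qed
  have diff_\<theta>: "((\<lambda>s. \<theta> s v) \<circ> chart_inv d) differentiable (at (snd d q))" for v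
  proof -
    obtain U where U: "open U" "q \<in> U" "U \<subseteq> fst d"
      "\<And>s. s \<in> U \<Longrightarrow> \<theta> s v = components B d s (\<Theta> s (?E v s))"
      using \<theta>_field[of v] by blast
    show ?thesis
    proof (rule differentiable_cong_open[of "snd d ` (fst d \<inter> U)"])
      show "open (snd d ` (fst d \<inter> U))" using d U by (intro N.open_coord_image)
      show "snd d q \<in> snd d ` (fst d \<inter> U)" using d U by blast
      show "N.local_rep d (\<lambda>s. \<Theta> s (?E v s)) differentiable (at (snd d q))"
        by (intro N.local_rep_differentiable smooth\<Theta> N.const_field d)
    qed (use d U in \<open>auto simp: N.local_rep_coord N.chart_inv_coord\<close>)
  qed
  let ?S = "snd c ` (fst c \<inter> F -` fst d)"
  have S: "open ?S" "snd c p \<in> ?S" using c d open_coordinate_dom by (auto simp: q_def)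
  have "((\<lambda>y. \<theta> (F (chart_inv c y)) (w y)) has_derivative
      (\<lambda>h. \<theta> (F (chart_inv c (snd c p))) (fderiv w (snd c p) h)
        + dir_deriv B (\<lambda>s. \<theta> s (w (snd c p))) q (differential A B F p h))) (at (snd c p))"
  proof (rule has_derivative_linear_family[OF S])
    show "linear (\<theta> (F (chart_inv c y)))" if "y \<in> ?S" for y
      using that c by (intro lin_\<theta>) (auto simp: M.chart_inv_coord)
    show "((\<lambda>y. \<theta> (F (chart_inv c y)) v) has_derivative
        (\<lambda>h. dir_deriv B (\<lambda>s. \<theta> s v) q (differential A B F p h))) (at (snd c p))" for v
      using has_derivative_along[OF c d(1) _ diff_\<theta>[of v, unfolded q_def]] d(2)
      by (simp add: dir_deriv_def differential_eq comp_def q_def c_def d_def)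
    show "(w has_derivative fderiv w (snd c p)) (at (snd c p))"
      using W by (intro has_derivative_fderiv) (simp add: w_def c_def d_def q_def)
  qed
  then have hd: "((\<lambda>y. \<theta> (F (chart_inv c y)) (w y)) has_derivative
      (\<lambda>h. \<Theta> q (fderiv w (snd c p) h)
        + dir_deriv B (\<lambda>s. \<theta> s (W p)) q (differential A B F p h))) (at (snd c p))"
    using c \<theta>_q N.components_chart_at[of q]
    by (simp add: M.chart_inv_coord w_def d_def flip: q_def)
  have "fderiv ((\<lambda>r. components B d (F r) (\<Theta> (F r) (W r))) \<circ> chart_inv c) (snd c p)
      = fderiv (\<lambda>y. \<theta> (F (chart_inv c y)) (w y)) (snd c p)"
    by (rule fderiv_cong[OF S])
      (use c in \<open>auto simp: w_def M.chart_inv_coord \<theta>_components\<close>)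
  then have product: "dir_deriv A (\<lambda>r. components B d (F r) (\<Theta> (F r) (W r))) p (X p)
      = \<Theta> q (dir_deriv A (\<lambda>r. components B d (F r) (W r)) p (X p))
        + dir_deriv B (\<lambda>s. \<theta> s (W p)) q (differential A B F p (X p))"
    using fderiv_eq[OF hd] by (simp add: dir_deriv_def w_def c_def)
  let ?x = "?E (push_field A B F X p)"
  have "\<Theta> q (nabla' ?x (?E (W p)) q) = nabla ?x (\<lambda>r. \<Theta> r (?E (W p) r)) q"
    by (simp add: gauge N.const_field)
  also have "\<dots> = dir_deriv B (\<lambda>s. components B d s (\<Theta> s (?E (W p) s))) q (?x q)
      + nabla ?x (?E (\<Theta> q (?E (W p) q))) q"
    unfolding d_def by (intro nabla_eq_const_field smooth\<Theta> N.const_field)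
  finally have christoffel: "\<Theta> q (nabla' ?x (?E (W p)) q)
      = dir_deriv B (\<lambda>s. \<theta> s (W p)) q (differential A B F p (X p)) + nabla ?x (?E (\<Theta> q (W p))) q"
    by (simp add: dir_\<theta> N.const_field_at push_field_def)
  show ?thesis
    using product christoffel by (simp add: connection_along_def linear_add[OF lin] flip: q_def d_def)
qed

end

section \<open>Tangential and normal parts\<close>

locale immersed_submanifold = smooth_mapping A B F
  for A :: "('a::t2_space, 'e::euclidean_space) chart set"
    and B :: "('b::t2_space, 'f::euclidean_space) chart set" and F :: "'a \<Rightarrow> 'b" +
  fixes g :: "'b \<Rightarrow> 'f \<Rightarrow> 'f \<Rightarrow> real"
  assumes inj_differential: "inj (differential A B F p)"
    and metric: "riemannian_metric B g"
begin

lemma bilinear_metric: "bilinear (g q)"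
  and metric_pos: "v \<noteq> 0 \<Longrightarrow> g q v v > 0"
  using metric by (auto simp: riemannian_metric_def)

lemma normal_space_diff:
  "u \<in> normal_space A B F g p \<Longrightarrow> v \<in> normal_space A B F g p \<Longrightarrow> u - v \<in> normal_space A B F g p"
  by (simp add: normal_space_def bilinear_lsub[OF bilinear_metric])

text \<open>A vector both tangent and normal is orthogonal to itself, and the differential is injective.\<close>

lemma normal_tangent_eq_0:
  assumes "differential A B F p v \<in> normal_space A B F g p" shows "v = 0"
proof -
  have "g (F p) (differential A B F p v) (differential A B F p v) = 0"
    using assms by (simp add: normal_space_def)
  then have "differential A B F p v = 0"
    using metric_pos[of "differential A B F p v" "F p"] by (metis less_irrefl)
  then show ?thesis
    using inj_differential linear_injective_0[OF linear_differential] by blast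
qed

text \<open>The tangential part solves \<open>L (dF v) = L w\<close>, where \<open>L z\<close> represents the functional \<open>u \<mapsto> g(z, dF u)\<close>.
  The map \<open>v \<mapsto> L (dF v)\<close> is injective by definiteness, hence onto in finite dimension.\<close>

lemma orthogonal_projection_exists: "\<exists>v. w - differential A B F p v \<in> normal_space A B F g p"
proof -
  let ?d = "differential A B F p" and ?g = "g (F p)"
  define L where "L z = (\<Sum>b\<in>Basis. ?g z (?d b) *\<^sub>R b)" for z
  have L_inner: "L z \<bullet> u = ?g z (?d u)" for z u
  proof -
    have "?g z (?d u) = (\<Sum>b\<in>Basis. (u \<bullet> b) *\<^sub>R ?g z (?d b))"
      using bilinear_metric unfolding bilinear_def
      by (intro linear_eq_sum_Basis[of "\<lambda>u. ?g z (?d u)"]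
          linear_compose[OF linear_differential, unfolded comp_def]) blast
    then show ?thesis by (simp add: L_def inner_sum_left inner_commute[of u] mult.commute)
  qed
  have lin: "linear (\<lambda>v. L (?d v))"
    by (rule linearI) (simp_all add: L_def linear_add[OF linear_differential]
        linear_cmul[OF linear_differential] bilinear_ladd[OF bilinear_metric]
        bilinear_lmul[OF bilinear_metric] scaleR_add_left sum.distrib scaleR_sum_right)
  have "v = 0" if "L (?d v) = 0" for v
  proof (rule normal_tangent_eq_0)
    show "?d v \<in> normal_space A B F g p"
      using L_inner[of "?d v"] that by (simp add: normal_space_def)
  qed
  then have "inj (\<lambda>v. L (?d v))" using linear_injective_0[OF lin] by blast
  then have "surj (\<lambda>v. L (?d v))" using linear_injective_imp_surjective[OF lin] by blast
  then obtain v where "L w = L (?d v)" by (metis surjD)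
  then have "?g w (?d u) = ?g (?d v) (?d u)" for u using L_inner by metis
  then show ?thesis
    by (intro exI[of _ v]) (simp add: normal_space_def bilinear_lsub[OF bilinear_metric])
qed

lemma tangential_part_eq:
  assumes "w - differential A B F p v \<in> normal_space A B F g p"
  shows "tangential_part A B F g p w = v"
  unfolding tangential_part_def
proof (rule the_equality)
  show "w - differential A B F p v \<in> normal_space A B F g p" by (rule assms)
  fix u assume "w - differential A B F p u \<in> normal_space A B F g p"
  from normal_space_diff[OF this assms] have "differential A B F p (v - u) \<in> normal_space A B F g p"
    by (simp add: linear_diff[OF linear_differential])
  then show "u = v" using normal_tangent_eq_0 by force
qed

lemma tangential_part_diff:
  "tangential_part A B F g p (u - v) = tangential_part A B F g p u - tangential_part A B F g p v"
proof (rule tangential_part_eq)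
  have mem: "w - differential A B F p (tangential_part A B F g p w) \<in> normal_space A B F g p" for w
    using orthogonal_projection_exists tangential_part_eq by metis
  show "u - v - differential A B F p (tangential_part A B F g p u - tangential_part A B F g p v)
      \<in> normal_space A B F g p"
    using normal_space_diff[OF mem[of u] mem[of v]]
    by (simp add: linear_diff[OF linear_differential] algebra_simps)
qed

lemma normal_part_diff:
  "normal_part A B F g p (u - v) = normal_part A B F g p u - normal_part A B F g p v"
  by (simp add: normal_part_def tangential_part_diff linear_diff[OF linear_differential])

end

section \<open>The bracket of tangent fields\<close>

text \<open>The identity \<open>\<Theta>[X, Y] = \<nabla>\<^sub>X(\<Theta>Y) - \<nabla>\<^sub>Y(\<Theta>X)\<close> for fields on the source of \<open>F\<close>, with bracket and
  fields regarded along \<open>F\<close>: torsion-freeness of \<open>\<nabla>\<^sup>*\<close>, followed by the gauge equation.  The two formulas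
  for CR submanifolds are its normal and its tangential part.\<close>

lemma theta_bracket:
  assumes M: "theta_statistical_manifold B g nabla nabla' \<Theta>"
    and "smooth_mapping A B F" and X: "smooth_field A X" and Y: "smooth_field A Y"
  shows "theta_along A B F \<Theta> p (lie_bracket A X Y p)
    = connection_along A B F nabla X (\<lambda>r. theta_along A B F \<Theta> r (Y r)) p
    - connection_along A B F nabla Y (\<lambda>r. theta_along A B F \<Theta> r (X r)) p"
proof -
  interpret smooth_mapping A B F by fact
  have nabla: "affine_connection B nabla" and tf: "torsion_free B nabla'"
    and \<Theta>: "tensor11_field B \<Theta>"
    and gauge: "\<And>X Y q. smooth_field B X \<Longrightarrow> smooth_field B Y \<Longrightarrow>
      nabla X (\<lambda>r. \<Theta> r (Y r)) q = \<Theta> q (nabla' X Y q)"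
    using M by (simp_all add: theta_statistical_manifold_def statistical_manifold_def)
  have lin: "linear (\<Theta> (F p))" using \<Theta> by (simp add: tensor11_field_def)
  have *: "connection_along A B F nabla V (\<lambda>r. theta_along A B F \<Theta> r (Z r)) p
      = \<Theta> (F p) (connection_along A B F nabla' V (push_field A B F Z) p)"
    if "smooth_field A Z" for V Z
    unfolding theta_along_def push_field_def[symmetric]
    by (intro connection_along_tensor[OF nabla \<Theta> gauge] push_field_differentiable that
        M.chart_at N.chart_at)
  show ?thesis
    unfolding *[OF X] *[OF Y] linear_diff[OF lin, symmetric]
      connection_along_torsion_free[OF tf X Y]
    by (simp only: theta_along_def)
qed

theorem theorem3p4:
  fixes A :: "('a::{t2_space, second_countable_topology}, 'e::euclidean_space) chart set"
    and B :: "('b::{t2_space, second_countable_topology}, 'f::euclidean_space) chart set"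
    and F :: "'a \<Rightarrow> 'b"
    and g :: "'b \<Rightarrow> 'f \<Rightarrow> 'f \<Rightarrow> real"
    and nabla nabla' :: "('b \<Rightarrow> 'f) \<Rightarrow> ('b \<Rightarrow> 'f) \<Rightarrow> 'b \<Rightarrow> 'f"
    and \<Theta> :: "'b \<Rightarrow> 'f \<Rightarrow> 'f"
    and D D' :: "'a \<Rightarrow> 'e set"
  defines "h \<equiv> second_fundamental_form A B F g nabla"
    and "S \<equiv> shape_operator A B F g nabla"
    and "\<Theta>t \<equiv> theta_tangent_field A B F \<Theta>"
    and "\<Theta>n \<equiv> (\<lambda>U p. theta_along A B F \<Theta> p (U p))"
  assumes "theta_statistical_manifold B g nabla nabla' \<Theta>"
    and "theta_CR_submanifold A B F g \<Theta> D D'"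
  shows "(\<forall>X\<in>sections A D. \<forall>Y\<in>sections A D. \<forall>p.
            theta_F A B F g \<Theta> p (lie_bracket A X Y p) = h X (\<Theta>t Y) p - h Y (\<Theta>t X) p) \<and>
         (\<forall>U\<in>sections A D'. \<forall>V\<in>sections A D'. \<forall>p.
            theta_P A B F g \<Theta> p (lie_bracket A U V p) = S (\<Theta>n U) V p - S (\<Theta>n V) U p) \<and>
         ((\<forall>p. {v. theta_F A B F g \<Theta> p v = 0} = D p) \<longrightarrow>
            (integrable_distribution A D \<longleftrightarrow>
              (\<forall>X\<in>sections A D. \<forall>Y\<in>sections A D. h X (\<Theta>t Y) = h Y (\<Theta>t X)))) \<and>
         ((\<forall>p. {v. theta_P A B F g \<Theta> p v = 0} = D' p) \<longrightarrow>
            (integrable_distribution A D' \<longleftrightarrow>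
              (\<forall>U\<in>sections A D'. \<forall>V\<in>sections A D'. S (\<Theta>n U) V = S (\<Theta>n V) U)))"
proof -
  interpret immersed_submanifold A B F g
    using assms(5,6) by unfold_locales
      (simp_all add: theta_statistical_manifold_def statistical_manifold_def
        theta_CR_submanifold_def immersion_def)
  note bracket = theta_bracket[OF assms(5) smooth_mapping_axioms]
  \<comment> \<open>on the invariant distribution the field along \<open>F\<close> that is \<open>\<Theta>Y\<close> comes from a field on the submanifold\<close>
  have push: "push_field A B F (\<Theta>t Y) = (\<lambda>r. theta_along A B F \<Theta> r (Y r))"
    if "Y \<in> sections A D" for Y
  proof
    fix r
    have "Y r \<in> D r" using that by (simp add: sections_def)
    then obtain v where v: "theta_along A B F \<Theta> r (Y r) = differential A B F r v"
      using assms(6) unfolding theta_CR_submanifold_def by blast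
    have "\<Theta>t Y r = v"
      unfolding \<Theta>t_def theta_tangent_field_def v
      by (rule the_equality) (auto dest: injD[OF inj_differential])
    then show "push_field A B F (\<Theta>t Y) r = theta_along A B F \<Theta> r (Y r)"
      by (simp add: push_field_def v)
  qed
  have 1: "theta_F A B F g \<Theta> p (lie_bracket A X Y p) = h X (\<Theta>t Y) p - h Y (\<Theta>t X) p"
    if "X \<in> sections A D" "Y \<in> sections A D" for X Y p
  proof -
    have "smooth_field A X" "smooth_field A Y" using that by (simp_all add: sections_def)
    from bracket[OF this] show ?thesis
      by (simp add: h_def theta_F_def second_fundamental_form_def push that normal_part_diff)
  qed
  have 2: "theta_P A B F g \<Theta> p (lie_bracket A U V p) = S (\<Theta>n U) V p - S (\<Theta>n V) U p"
    if "U \<in> sections A D'" "V \<in> sections A D'" for U V p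
  proof -
    have "smooth_field A U" "smooth_field A V" using that by (simp_all add: sections_def)
    from bracket[OF this] show ?thesis
      by (simp add: S_def \<Theta>n_def theta_P_def shape_operator_def tangential_part_diff)
  qed
  have smooth: "smooth_field A (lie_bracket A X Y)"
    if "X \<in> sections A E" "Y \<in> sections A E" for X Y E
    using that by (simp add: sections_def M.smooth_field_lie_bracket)
  have 3: "integrable_distribution A D \<longleftrightarrow>
      (\<forall>X\<in>sections A D. \<forall>Y\<in>sections A D. h X (\<Theta>t Y) = h Y (\<Theta>t X))"
    if ker: "\<forall>p. {v. theta_F A B F g \<Theta> p v = 0} = D p"
  proof -
    have "lie_bracket A X Y \<in> sections A D \<longleftrightarrow> h X (\<Theta>t Y) = h Y (\<Theta>t X)"
      if XY: "X \<in> sections A D" "Y \<in> sections A D" for X Y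
    proof -
      have "lie_bracket A X Y \<in> sections A D \<longleftrightarrow> (\<forall>p. theta_F A B F g \<Theta> p (lie_bracket A X Y p) = 0)"
        using ker smooth[OF XY] by (auto simp: sections_def)
      then show ?thesis by (simp add: 1[OF XY] fun_eq_iff)
    qed
    then show ?thesis by (simp add: integrable_distribution_def)
  qed
  have 4: "integrable_distribution A D' \<longleftrightarrow>
      (\<forall>U\<in>sections A D'. \<forall>V\<in>sections A D'. S (\<Theta>n U) V = S (\<Theta>n V) U)"
    if ker: "\<forall>p. {v. theta_P A B F g \<Theta> p v = 0} = D' p"
  proof -
    have "lie_bracket A U V \<in> sections A D' \<longleftrightarrow> S (\<Theta>n U) V = S (\<Theta>n V) U"
      if UV: "U \<in> sections A D'" "V \<in> sections A D'" for U V
    proof -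
      have "lie_bracket A U V \<in> sections A D' \<longleftrightarrow> (\<forall>p. theta_P A B F g \<Theta> p (lie_bracket A U V p) = 0)"
        using ker smooth[OF UV] by (auto simp: sections_def)
      then show ?thesis by (simp add: 2[OF UV] fun_eq_iff)
    qed
    then show ?thesis by (simp add: integrable_distribution_def)
  qed
  show ?thesis using 1 2 3 4 by blast
qed

end
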